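(* For every constant $\gamma>0$ there exist constants $c,C>0$ (depending only on $\gamma$) such that the following holds. Let $1\le k\le d$ be integers and $\alpha\in(0,1/2)$, and let $\mathbf{P}_{d,L,B,\alpha}$ denote a distribution chosen uniformly at random from the family $\mathcal{P}_{d,k,\alpha}$ (i.e., $(L,B)$ uniform over $\{(\ell,b):\ell\subseteq[d],1\le|\ell|\le k,b\in\{\pm1\}\}$). If $M$ is an $(\varepsilon,\delta)$-pan-private online algorithm on streams of length $n$ such that $\delta\log\big(\binom{d}{\le k}/\delta\big)\le c\,\alpha^2\varepsilon^2/\binom{d}{\le k}$ and $d_{TV}(M(\mathbf{P}^n_{d,L,B,\alpha}),M(\mathbf{U}^n))\ge\gamma$, then $n\ge C\sqrt{\binom{d}{\le k}}/(\alpha\varepsilon)$.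
   Context: $\binom{d}{\le k}=\sum_{j=1}^k\binom{d}{j}$, $[d]=\{1,\dots,d\}$, $\mathcal{X}=\{\pm1\}^d$, and $\mathbf{U}$ is the uniform distribution on $\{\pm1\}^d$. For nonempty $\ell\subseteq[d]$ and $b\in\{\pm1\}$, $\mathbf{P}_{d,\ell,b,\alpha}$ is the distribution on $\{\pm1\}^d$ with mass $(1+2\alpha b\prod_{i\in\ell}x_i)2^{-d}$ at $x$. $\mathcal{P}_{d,k,\alpha}=\{\mathbf{P}_{d,\ell,b,\alpha}:\ell\subseteq[d],1\le|\ell|\le k,b\in\{\pm1\}\}$. $\mathbf{P}^n_{d,L,B,\alpha}$ denotes drawing $(L,B)$ once uniformly and then $n$ i.i.d. samples from $\mathbf{P}_{d,L,B,\alpha}$; $M(\mathbf{D})$ is the output distribution of $M$ on a stream drawn from $\mathbf{D}$. Pan-privacy: An online algorithm $M$ on streams $\vec x=(x_1,\dots,x_n)$ over $\mathcal{X}$ consists of randomized maps $M_1:\mathcal{X}\to\mathcal{I}$, $M_i:\mathcal{X}\times\mathcal{I}\to\mathcal{I}$ ($i\ge2$) and an output map $M_{\mathcal{O}}:\mathcal{I}\to\mathcal{O}$; it computes $s_1=M_1(x_1)$, $s_i=M_i(x_i,s_{i-1})$. $M_{\mathcal{I}}(\vec x)$ is the internal state after processing $\vec x$, $\vec x_{\le t}$ the first $t$ elements, and the output is $M(\vec x)=M_{\mathcal{O}}(M_{\mathcal{I}}(\vec x))$. Streams are neighbors if they differ in at most one element. $M$ is $(\varepsilon,\delta)$-pan-private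 if for all neighboring $\vec x,\vec x'$, every $t$ and every $T\subseteq\mathcal{I}\times\mathcal{O}$, $\Pr[(M_{\mathcal{I}}(\vec x_{\le t}),M_{\mathcal{O}}(M_{\mathcal{I}}(\vec x)))\in T]\le e^{\varepsilon}\Pr[(M_{\mathcal{I}}(\vec x'_{\le t}),M_{\mathcal{O}}(M_{\mathcal{I}}(\vec x')))\in T]+\delta$ (state and output from the same run).
   Formalization: ε is bounded by an arbitrary ε₀ on which c, C may depend (false for unbounded ε: k=d, ε=ln(2^d+1)); for d=1, δ≤1/2 is required (false at δ=1). Formally c, C may also vary with the type of states and outputs; discrete spaces relabel into one type. *)

theory Defs
  imports "HOL-Probability.Probability"
begin

definition cube :: "nat \<Rightarrow> (nat \<Rightarrow> real) set" where
  "cube d = {1..d} \<rightarrow>\<^sub>E {-1, 1}"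

definition unif_dist :: "nat \<Rightarrow> (nat \<Rightarrow> real) measure" where
  "unif_dist d = uniform_count_measure (cube d)"

definition parity_dist :: "nat \<Rightarrow> nat set \<Rightarrow> real \<Rightarrow> real \<Rightarrow> (nat \<Rightarrow> real) measure" where
  "parity_dist d l b \<alpha> =
     point_measure (cube d) (\<lambda>x. ennreal ((1 + 2 * \<alpha> * b * (\<Prod>i\<in>l. x i)) / 2 ^ d))"

definition parity_params :: "nat \<Rightarrow> nat \<Rightarrow> (nat set \<times> real) set" where
  "parity_params d k = {(l, b). l \<subseteq> {1..d} \<and> 1 \<le> card l \<and> card l \<le> k \<and> b \<in> {-1, 1}}"

text \<open>The sum starts at 1: the empty set is not counted.\<close>

definition binom_le :: "nat \<Rightarrow> nat \<Rightarrow> nat" where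
  "binom_le d k = (\<Sum>j=1..k. d choose j)"

definition streams_of :: "nat \<Rightarrow> nat \<Rightarrow> (nat \<Rightarrow> nat \<Rightarrow> real) set" where
  "streams_of d n = {1..n} \<rightarrow>\<^sub>E cube d"

definition iid :: "nat \<Rightarrow> 'a measure \<Rightarrow> (nat \<Rightarrow> 'a) measure" where
  "iid n D = (\<Pi>\<^sub>M i\<in>{1..n}. D)"

text \<open>The pair \<open>(l, b)\<close> is drawn once and is shared by all \<open>n\<close> samples.\<close>

definition parity_mixture_iid :: "nat \<Rightarrow> nat \<Rightarrow> real \<Rightarrow> nat \<Rightarrow> (nat \<Rightarrow> nat \<Rightarrow> real) measure" where
  "parity_mixture_iid d k \<alpha> n =
     uniform_count_measure (parity_params d k) \<bind> (\<lambda>(l, b). iid n (parity_dist d l b \<alpha>))"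

definition tv_dist :: "'a measure \<Rightarrow> 'a measure \<Rightarrow> real" where
  "tv_dist P Q = (SUP A\<in>sets P. \<bar>measure P A - measure Q A\<bar>)"

text \<open>State space and output space are arbitrary measurable spaces, and randomized maps are Markov
  kernels. Discrete spaces are the instances \<open>count_space\<close>.\<close>

record ('i, 'o) online_alg =
  state_space :: "'i measure"
  output_space :: "'o measure"
  init_map :: "(nat \<Rightarrow> real) \<Rightarrow> 'i measure"
  step_map :: "nat \<Rightarrow> (nat \<Rightarrow> real) \<Rightarrow> 'i \<Rightarrow> 'i measure"
  output_map :: "'i \<Rightarrow> 'o measure"

definition online_algorithm :: "nat \<Rightarrow> nat \<Rightarrow> ('i, 'o) online_alg \<Rightarrow> bool" where
  "online_algorithm d n M \<longleftrightarrow>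
     (\<forall>x\<in>cube d. init_map M x \<in> space (prob_algebra (state_space M))) \<and>
     (\<forall>i\<in>{2..n}. \<forall>x\<in>cube d.
        step_map M i x \<in> state_space M \<rightarrow>\<^sub>M prob_algebra (state_space M)) \<and>
     output_map M \<in> state_space M \<rightarrow>\<^sub>M prob_algebra (output_space M)"

text \<open>\<open>steps_from M x t m s\<close> is the law of the state after the elements \<open>x (t+1), \<dots>, x (t+m)\<close>
  have been processed, starting in state \<open>s\<close> at time \<open>t\<close>.\<close>

primrec steps_from ::
  "('i, 'o) online_alg \<Rightarrow> (nat \<Rightarrow> nat \<Rightarrow> real) \<Rightarrow> nat \<Rightarrow> nat \<Rightarrow> 'i \<Rightarrow> 'i measure" where
  "steps_from M x t 0 s = return (state_space M) s"
| "steps_from M x t (Suc m) s =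
     steps_from M x t m s \<bind> step_map M (t + Suc m) (x (t + Suc m))"

text \<open>Meaningful for \<open>t \<ge> 1\<close> only: there is no state before the first element.\<close>

definition state_after ::
  "('i, 'o) online_alg \<Rightarrow> (nat \<Rightarrow> nat \<Rightarrow> real) \<Rightarrow> nat \<Rightarrow> 'i measure" where
  "state_after M x t = init_map M (x 1) \<bind> steps_from M x 1 (t - 1)"

definition run_alg ::
  "('i, 'o) online_alg \<Rightarrow> nat \<Rightarrow> (nat \<Rightarrow> nat \<Rightarrow> real) \<Rightarrow> 'o measure" where
  "run_alg M n x = state_after M x n \<bind> output_map M"

definition output_dist ::
  "('i, 'o) online_alg \<Rightarrow> nat \<Rightarrow> (nat \<Rightarrow> nat \<Rightarrow> real) measure \<Rightarrow> 'o measure" where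
  "output_dist M n D = D \<bind> run_alg M n"

text \<open>The joint law, within a single run on \<open>x\<close>, of the state at time \<open>t\<close> and the final output.\<close>

definition state_output_law ::
  "('i, 'o) online_alg \<Rightarrow> nat \<Rightarrow> (nat \<Rightarrow> nat \<Rightarrow> real) \<Rightarrow> nat \<Rightarrow> ('i \<times> 'o) measure" where
  "state_output_law M n x t =
     state_after M x t \<bind> (\<lambda>s.
       (steps_from M x t (n - t) s \<bind> output_map M) \<bind> (\<lambda>y.
         return (state_space M \<Otimes>\<^sub>M output_space M) (s, y)))"

definition neighbors :: "nat \<Rightarrow> (nat \<Rightarrow> 'a) \<Rightarrow> (nat \<Rightarrow> 'a) \<Rightarrow> bool" where
  "neighbors n x x' \<longleftrightarrow> card {i\<in>{1..n}. x i \<noteq> x' i} \<le> 1"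

text \<open>As usual on general measurable spaces, the events \<open>T\<close> are the measurable ones.\<close>

definition pan_private :: "nat \<Rightarrow> nat \<Rightarrow> real \<Rightarrow> real \<Rightarrow> ('i, 'o) online_alg \<Rightarrow> bool" where
  "pan_private d n \<epsilon> \<delta> M \<longleftrightarrow>
     (\<forall>x\<in>streams_of d n. \<forall>x'\<in>streams_of d n. neighbors n x x' \<longrightarrow>
       (\<forall>t\<in>{1..n}. \<forall>T\<in>sets (state_space M \<Otimes>\<^sub>M output_space M).
          measure (state_output_law M n x t) T
            \<le> exp \<epsilon> * measure (state_output_law M n x' t) T + \<delta>))"

end

theory Submission
  imports Defs
begin

text \<open>
  Replace the elements of a uniform stream by elements from the parity distribution one at a time, so
  that the \<open>t\<close>-th hybrid has a uniform prefix and a parity-distributed suffix. Consecutive hybrids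
  differ only in one element, and everything after that element is a post-processing of the current
  state, whose law \<open>h y\<close> depends privately on the value \<open>y\<close> of that element. The change therefore is
  \<open>2 \<alpha>\<close> times the correlation of \<open>h y\<close> with a character, tested against a function which may depend
  on the character. By Bessel's inequality the privacy budget \<open>exp \<epsilon> - 1\<close> is shared among all \<open>N\<close>
  characters, so that the average correlation is at most \<open>(exp \<epsilon> - 1) / sqrt N + 2 \<delta>\<close>. Summing over
  \<open>n\<close> elements bounds the total variation distance, and the condition on \<open>\<delta>\<close> makes the second term at most of the order of the first.
\<close>

section \<open>Comparison of integrals under an approximate measure inequality\<close>

lemma floor_real_eq_card:
  assumes "0 \<le> v" "v \<le> 1"
  shows "of_int \<lfloor>real m * v\<rfloor> = (\<Sum>j=1..m. if real j \<le> real m * v then 1 else (0::real))"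
proof -
  define N where "N = nat \<lfloor>real m * v\<rfloor>"
  have "0 \<le> real m * v" using assms by simp
  then have N: "\<lfloor>real m * v\<rfloor> = int N" by (simp add: N_def)
  have iff: "real j \<le> real m * v \<longleftrightarrow> j \<le> N" for j
    using N by (metis le_floor_iff of_int_of_nat_eq of_nat_le_iff)
  have "real m * v \<le> real m * 1" using assms by (intro mult_left_mono) auto
  then have "N \<le> m" using iff[of N] by (metis le_floor_iff N mult.right_neutral of_int_of_nat_eq of_nat_le_iff order_refl order_trans)
  then have "{1..m} \<inter> {j. j \<le> N} = {1..N}" by auto
  then show ?thesis by (simp add: iff N sum.If_cases)
qed

text \<open>Writing \<open>\<lfloor>m f\<rfloor> / m\<close> as an average of \<open>m\<close> indicators of upper level sets of \<open>f\<close> costs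
  \<open>\<delta>\<close> per unit of height and loses \<open>1 / m\<close>.\<close>

lemma integral_le_of_measure_le:
  fixes a \<delta> B :: real
  assumes "prob_space P" "prob_space Q" and sets: "sets Q = sets P"
    and dp: "\<And>A. A \<in> sets P \<Longrightarrow> measure P A \<le> a * measure Q A + \<delta>" and "0 \<le> a"
    and f: "f \<in> borel_measurable P" "\<And>x. x \<in> space P \<Longrightarrow> 0 \<le> f x" "\<And>x. x \<in> space P \<Longrightarrow> f x \<le> B"
    and "0 < B"
  shows "integral\<^sup>L P f \<le> a * integral\<^sup>L Q f + \<delta> * B"
proof -
  interpret P: prob_space P by fact
  interpret Q: prob_space Q by fact
  have sp: "space Q = space P" using sets by (rule sets_eq_imp_space_eq)
  define g where "g = (\<lambda>x. f x / B)"
  have g[measurable]: "g \<in> borel_measurable P" using f(1) unfolding g_def by measurable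
  have g01: "0 \<le> g x" "g x \<le> 1" if "x \<in> space P" for x
    using f(2,3)[OF that] \<open>0 < B\<close> by (auto simp: g_def)
  have gQ[measurable]: "g \<in> borel_measurable Q" using g by (simp cong: measurable_cong_sets add: sets)
  have intP: "integrable P g" by (rule P.integrable_const_bound[where B=1]) (use g01 in auto)
  have intQ: "integrable Q g" by (rule Q.integrable_const_bound[where B=1]) (use g01 sp in auto)
  have step: "integral\<^sup>L P g \<le> a * integral\<^sup>L Q g + \<delta> + inverse (real m)" if "m > 0" for m :: nat
  proof -
    define L where "L = (\<lambda>j. {x \<in> space P. real j \<le> real m * g x})"
    have L[measurable]: "L j \<in> sets P" for j unfolding L_def by measurable
    have LQ[measurable]: "L j \<in> sets Q" for j using L sets by simp
    define h where "h = (\<lambda>x. (\<Sum>j=1..m. indicator (L j) x) / real m)"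
    have h: "h x = of_int \<lfloor>real m * g x\<rfloor> / real m" if "x \<in> space P" for x
      using floor_real_eq_card[OF g01[OF that], of m] that
      by (simp add: h_def L_def indicator_def of_bool_def)
    have hP: "integral\<^sup>L P h = (\<Sum>j=1..m. measure P (L j)) / real m"
      unfolding h_def by (simp add: Bochner_Integration.integral_sum P.emeasure_eq_measure)
    have hQ: "integral\<^sup>L Q h = (\<Sum>j=1..m. measure Q (L j)) / real m"
      unfolding h_def by (simp add: Bochner_Integration.integral_sum Q.emeasure_eq_measure)
    have ihP: "integrable P h" unfolding h_def by (auto simp: P.emeasure_eq_measure)
    have ihQ: "integrable Q h" unfolding h_def by (auto simp: Q.emeasure_eq_measure)
    have "integral\<^sup>L P g \<le> integral\<^sup>L P (\<lambda>x. h x + inverse (real m))"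
    proof (rule integral_mono[OF intP])
      fix x assume x: "x \<in> space P"
      have "real m * g x \<le> of_int \<lfloor>real m * g x\<rfloor> + 1" by linarith
      then show "g x \<le> h x + inverse (real m)"
        using \<open>m > 0\<close> by (simp add: h[OF x] field_simps)
    qed (use ihP in auto)
    also have "\<dots> = integral\<^sup>L P h + inverse (real m)" using ihP by (simp add: P.prob_space)
    also have "integral\<^sup>L P h \<le> (\<Sum>j=1..m. a * measure Q (L j) + \<delta>) / real m"
      unfolding hP by (intro divide_right_mono sum_mono dp) auto
    also have "\<dots> = a * integral\<^sup>L Q h + \<delta>"
      using \<open>m > 0\<close> by (simp add: hQ sum.distrib sum_distrib_left[symmetric] field_simps)
    also have "integral\<^sup>L Q h \<le> integral\<^sup>L Q g"
    proof (rule integral_mono[OF ihQ intQ])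
      fix x assume x: "x \<in> space Q"
      have "of_int \<lfloor>real m * g x\<rfloor> \<le> real m * g x" by linarith
      then show "h x \<le> g x" using x sp \<open>m > 0\<close> by (simp add: h divide_le_eq mult.commute)
    qed
    finally show ?thesis using \<open>0 \<le> a\<close> by (auto simp: mult_left_mono)
  qed
  have "integral\<^sup>L P g \<le> a * integral\<^sup>L Q g + \<delta>"
  proof (rule field_le_epsilon)
    fix e :: real assume "0 < e"
    then obtain m where "m > 0" "inverse (real m) < e"
      using ex_inverse_of_nat_less by blast
    with step[OF \<open>m > 0\<close>] show "integral\<^sup>L P g \<le> a * integral\<^sup>L Q g + \<delta> + e" by simp
  qed
  then show ?thesis
    using \<open>0 < B\<close> unfolding g_def by (simp add: field_simps)
qed

section \<open>Characters of the cube\<close>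

lemma finite_cube [simp]: "finite (cube d)"
  by (auto simp: cube_def intro!: finite_PiE)

lemma card_cube [simp]: "card (cube d) = 2 ^ d"
  by (simp add: cube_def card_PiE numeral_2_eq_2)

lemma cube_nonempty [simp]: "cube d \<noteq> {}"
  by (metis card_cube card.empty power_not_zero zero_neq_numeral)

lemma cube_coord: "y \<in> cube d \<Longrightarrow> i \<in> {1..d} \<Longrightarrow> y i = 1 \<or> y i = -1"
  by (auto simp: cube_def PiE_def Pi_def)

lemma abs_character: "y \<in> cube d \<Longrightarrow> l \<subseteq> {1..d} \<Longrightarrow> \<bar>prod y l\<bar> = 1"
  unfolding abs_prod by (rule prod.neutral) (use cube_coord in fastforce)

text \<open>The sum over the cube factorizes over the coordinates. A coordinate lying in exactly one
  of the two sets contributes \<open>-1 + 1 = 0\<close>, every other coordinate contributes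
  2.\<close>

lemma characters_orthogonal:
  assumes "l \<subseteq> {1..d}" "l' \<subseteq> {1..d}"
  shows "(\<Sum>y\<in>cube d. prod y l * prod y l') = (if l = l' then 2 ^ d else 0)"
proof -
  have fin: "finite l" "finite l'" using assms finite_subset by blast+
  let ?f = "\<lambda>i v. (if i \<in> l then v else 1) * (if i \<in> l' then v else (1::real))"
  have "(\<Sum>y\<in>cube d. prod y l * prod y l') = (\<Sum>y\<in>cube d. \<Prod>i=1..d. ?f i (y i))"
    using assms by (intro sum.cong) (auto simp: prod.distrib prod.If_cases Int_absorb1 inf.absorb2)
  also have "\<dots> = (\<Prod>i=1..d. \<Sum>v\<in>{-1, 1}. ?f i v)"
    unfolding cube_def by (rule prod_sum_PiE[symmetric]) auto
  also have "\<dots> = (\<Prod>i=1..d. if i \<in> l \<longleftrightarrow> i \<in> l' then 2 else 0)"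
    by (intro prod.cong) auto
  also have "\<dots> = (if l = l' then 2 ^ d else 0)"
  proof (cases "l = l'")
    case False
    then obtain i where "i \<in> {1..d}" "\<not> (i \<in> l \<longleftrightarrow> i \<in> l')" using assms by blast
    then show ?thesis using False by (auto intro!: prod_zero)
  qed simp
  finally show ?thesis .
qed

lemma sum_character: "l \<subseteq> {1..d} \<Longrightarrow> l \<noteq> {} \<Longrightarrow> (\<Sum>y\<in>cube d. prod y l) = 0"
  using characters_orthogonal[of l d "{}"] by simp

text \<open>Orthogonality bounds the mean square of the polynomial by \<open>card \<Lambda>\<close>,
  and Cauchy-Schwarz against the constant 1 passes to the first absolute moment. The gain over the
  trivial bound \<open>card \<Lambda>\<close> is the source of the square root in the final bound on
  \<open>n\<close>.\<close>

lemma sum_abs_character_polynomial_le: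
  assumes "finite \<Lambda>" "\<And>l. l \<in> \<Lambda> \<Longrightarrow> l \<subseteq> {1..d}" and "\<And>l. l \<in> \<Lambda> \<Longrightarrow> \<bar>c l\<bar> \<le> 1"
  shows "(\<Sum>y\<in>cube d. \<bar>\<Sum>l\<in>\<Lambda>. c l * prod y l\<bar>) \<le> 2 ^ d * sqrt (card \<Lambda>)"
proof -
  let ?G = "\<lambda>y. \<Sum>l\<in>\<Lambda>. c l * prod y l"
  have "(\<Sum>y\<in>cube d. (?G y)\<^sup>2) = (\<Sum>y\<in>cube d. \<Sum>l\<in>\<Lambda>. \<Sum>l'\<in>\<Lambda>. c l * c l' * (prod y l * prod y l'))"
    by (simp add: power2_eq_square sum_product mult_ac)
  also have "\<dots> = (\<Sum>l\<in>\<Lambda>. \<Sum>l'\<in>\<Lambda>. c l * c l' * (\<Sum>y\<in>cube d. prod y l * prod y l'))"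
    by (subst sum.swap, intro sum.cong refl, subst sum.swap) (simp add: sum_distrib_left)
  also have "\<dots> = (\<Sum>l\<in>\<Lambda>. \<Sum>l'\<in>\<Lambda>. if l' = l then c l * c l' * 2 ^ d else 0)"
    using assms(2) by (intro sum.cong refl) (auto simp: characters_orthogonal)
  also have "\<dots> = (\<Sum>l\<in>\<Lambda>. (c l)\<^sup>2 * 2 ^ d)"
    using assms(1) by (simp add: power2_eq_square)
  also have "\<dots> \<le> (\<Sum>l\<in>\<Lambda>. 1 * 2 ^ d)"
    using assms(3) by (intro sum_mono mult_right_mono) (auto simp: abs_square_le_1)
  finally have sq: "(\<Sum>y\<in>cube d. (?G y)\<^sup>2) \<le> card \<Lambda> * 2 ^ d" by simp
  have "(\<Sum>y\<in>cube d. \<bar>?G y\<bar>) = (\<Sum>y\<in>cube d. \<bar>?G y\<bar> * \<bar>1\<bar>)" by simp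
  also have "\<dots> \<le> L2_set ?G (cube d) * L2_set (\<lambda>_. 1) (cube d)"
    by (rule L2_set_mult_ineq)
  also have "\<dots> \<le> sqrt (card \<Lambda> * 2 ^ d) * sqrt (2 ^ d)"
    unfolding L2_set_def using sq by (intro mult_mono) auto
  also have "\<dots> = 2 ^ d * sqrt (card \<Lambda>)"
    by (simp add: real_sqrt_mult)
  finally show ?thesis .
qed

section \<open>Correlation of a private channel with the characters\<close>

text \<open>The positive part of \<open>f\<close> is moved from \<open>P\<close> to
  \<open>Q\<close>; for the negative part, which enters with a minus sign, the privacy inequality is
  used in the other direction. The multiplicative loss is charged to the integral of
  \<open>\<bar>f\<bar>\<close> under \<open>Q\<close>, which can be far below \<open>B\<close>; only
  the \<open>\<delta>\<close> terms pay for the supremum.\<close>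

lemma integral_le_integral_of_dp:
  fixes \<epsilon> \<delta> B :: real
  assumes P: "prob_space P" and Q: "prob_space Q" and sets: "sets Q = sets P"
    and dp: "\<And>A. A \<in> sets P \<Longrightarrow> measure P A \<le> exp \<epsilon> * measure Q A + \<delta>"
      "\<And>A. A \<in> sets P \<Longrightarrow> measure Q A \<le> exp \<epsilon> * measure P A + \<delta>"
    and "0 \<le> \<epsilon>" "0 \<le> \<delta>" "0 < B"
    and f: "f \<in> borel_measurable P" and B: "\<And>x. x \<in> space P \<Longrightarrow> \<bar>f x\<bar> \<le> B"
  shows "integral\<^sup>L P f \<le> integral\<^sup>L Q f + (exp \<epsilon> - 1) * (\<integral>x. \<bar>f x\<bar> \<partial>Q) + 2 * \<delta> * B"
proof -
  interpret P: prob_space P by fact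
  interpret Q: prob_space Q by fact
  have sp: "space Q = space P" using sets by (rule sets_eq_imp_space_eq)
  have fQ: "f \<in> borel_measurable Q" using f by (simp cong: measurable_cong_sets add: sets)
  note [measurable] = f fQ
  let ?p = "\<lambda>x. max 0 (f x)" and ?m = "\<lambda>x. max 0 (- f x)"
  have int: "integrable P ?p" "integrable P ?m" "integrable Q ?p" "integrable Q ?m"
    using B sp by (force intro!: P.integrable_const_bound[where B=B] Q.integrable_const_bound[where B=B])+
  have "integral\<^sup>L P ?p \<le> exp \<epsilon> * integral\<^sup>L Q ?p + \<delta> * B"
    by (rule integral_le_of_measure_le[OF P Q sets dp(1)]) (use B \<open>0 < B\<close> in force)+
  moreover have "integral\<^sup>L Q ?m \<le> exp \<epsilon> * integral\<^sup>L P ?m + \<delta> * B"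
    by (rule integral_le_of_measure_le[OF Q P sets[symmetric]]) (use dp(2) sets sp B \<open>0 < B\<close> in force)+
  then have "integral\<^sup>L Q ?m - \<delta> * B \<le> exp \<epsilon> * integral\<^sup>L P ?m" by simp
  then have "exp (-\<epsilon>) * (integral\<^sup>L Q ?m - \<delta> * B) \<le> integral\<^sup>L P ?m"
    by (simp add: exp_minus field_simps)
  moreover have "exp (-\<epsilon>) * (\<delta> * B) \<le> \<delta> * B"
    using \<open>0 \<le> \<epsilon>\<close> \<open>0 \<le> \<delta>\<close> \<open>0 < B\<close> by (simp add: mult_left_le_one_le)
  \<comment> \<open>The factor \<open>exp (-\<epsilon>)\<close> is weakened to
    \<open>2 - exp \<epsilon> = 1 - (exp \<epsilon> - 1)\<close>, so that both parts of
    \<open>f\<close> lose the same factor \<open>exp \<epsilon> - 1\<close>.\<close>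
  moreover have "(2 - exp \<epsilon>) * integral\<^sup>L Q ?m \<le> exp (-\<epsilon>) * integral\<^sup>L Q ?m"
  proof (intro mult_right_mono)
    have "2 - exp \<epsilon> \<le> 1 - \<epsilon>" using exp_ge_add_one_self[of \<epsilon>] by linarith
    also have "\<dots> \<le> exp (-\<epsilon>)" using exp_ge_add_one_self[of "-\<epsilon>"] by simp
    finally show "2 - exp \<epsilon> \<le> exp (-\<epsilon>)" .
  qed simp
  moreover have "integral\<^sup>L P f = integral\<^sup>L P ?p - integral\<^sup>L P ?m"
    unfolding Bochner_Integration.integral_diff[OF int(1,2), symmetric]
    by (intro Bochner_Integration.integral_cong) auto
  moreover have "integral\<^sup>L Q f = integral\<^sup>L Q ?p - integral\<^sup>L Q ?m"
    unfolding Bochner_Integration.integral_diff[OF int(3,4), symmetric]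
    by (intro Bochner_Integration.integral_cong) auto
  moreover have "(\<integral>x. \<bar>f x\<bar> \<partial>Q) = integral\<^sup>L Q ?p + integral\<^sup>L Q ?m"
    unfolding Bochner_Integration.integral_add[OF int(3,4), symmetric]
    by (intro Bochner_Integration.integral_cong) auto
  ultimately show ?thesis by (simp add: algebra_simps)
qed

lemma
  fixes f :: "'a \<Rightarrow> real"
  assumes P: "P \<in> space (prob_algebra S)" and f: "f \<in> borel_measurable S"
    "\<And>x. x \<in> space S \<Longrightarrow> \<bar>f x\<bar> \<le> B"
  shows integrable_prob_algebra: "integrable P f"
    and abs_integral_prob_algebra_le: "\<bar>integral\<^sup>L P f\<bar> \<le> B"
proof -
  interpret prob_space P using P by (simp add: space_prob_algebra)
  have sp: "sets P = sets S" "space P = space S"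
    using P by (auto simp: space_prob_algebra dest: sets_eq_imp_space_eq)
  show int: "integrable P f"
    using f sp by (intro integrable_const_bound[where B=B]) (auto cong: measurable_cong_sets)
  have "\<bar>integral\<^sup>L P f\<bar> \<le> (\<integral>x. \<bar>f x\<bar> \<partial>P)" by (rule integral_abs_bound)
  also have "\<dots> \<le> (\<integral>x. B \<partial>P)" using int f(2) sp by (intro integral_mono) auto
  finally show "\<bar>integral\<^sup>L P f\<bar> \<le> B" by (simp add: prob_space)
qed

text \<open>With \<open>\<sigma> l\<close> the sign of the \<open>l\<close>-th term, the sum of absolute values is the sum over \<open>y\<close> of
  \<open>\<integral> G y d(h y)\<close> for \<open>G y = (\<Sum>l. \<sigma> l * \<psi> l * prod y l)\<close>. Since \<open>G y\<close> has mean zero over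
  the cube, replacing every \<open>h y\<close> by one fixed \<open>h y\<^sub>0\<close> leaves only the privacy error.\<close>

lemma sum_dp_character_correlation_le:
  fixes \<epsilon> \<delta> :: real
  assumes h: "\<And>y. y \<in> cube d \<Longrightarrow> h y \<in> space (prob_algebra S)"
    and dp: "\<And>y y' A. y \<in> cube d \<Longrightarrow> y' \<in> cube d \<Longrightarrow> A \<in> sets S \<Longrightarrow>
      measure (h y) A \<le> exp \<epsilon> * measure (h y') A + \<delta>"
    and "0 \<le> \<epsilon>" "0 \<le> \<delta>"
    and \<Lambda>: "finite \<Lambda>" "\<And>l. l \<in> \<Lambda> \<Longrightarrow> l \<subseteq> {1..d}" "{} \<notin> \<Lambda>"
    and \<psi>: "\<And>l. l \<in> \<Lambda> \<Longrightarrow> \<psi> l \<in> borel_measurable S"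
      "\<And>l s. l \<in> \<Lambda> \<Longrightarrow> s \<in> space S \<Longrightarrow> \<bar>\<psi> l s\<bar> \<le> 1"
  shows "(\<Sum>l\<in>\<Lambda>. \<bar>\<Sum>y\<in>cube d. prod y l * integral\<^sup>L (h y) (\<psi> l)\<bar>)
    \<le> 2 ^ d * ((exp \<epsilon> - 1) * sqrt (card \<Lambda>) + 2 * \<delta> * card \<Lambda>)"
proof (cases "\<Lambda> = {}")
  case False
  obtain y0 where y0: "y0 \<in> cube d" using cube_nonempty by blast
  have prob: "prob_space (h y)" and sets [measurable_cong]: "sets (h y) = sets S"
    and sp: "space (h y) = space S" if "y \<in> cube d" for y
    using h[OF that] by (auto simp: space_prob_algebra dest: sets_eq_imp_space_eq)
  have int\<psi>: "integrable (h y) (\<psi> l)" if "y \<in> cube d" "l \<in> \<Lambda>" for y l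
    using integrable_prob_algebra[OF h \<psi>] that by blast
  define \<sigma> where "\<sigma> = (\<lambda>l. sgn (\<Sum>y\<in>cube d. prod y l * integral\<^sup>L (h y) (\<psi> l)))"
  have \<sigma>: "\<bar>\<sigma> l\<bar> \<le> 1" for l by (simp add: \<sigma>_def sgn_if)
  define G where "G = (\<lambda>y s. \<Sum>l\<in>\<Lambda>. \<sigma> l * \<psi> l s * prod y l)"
  have G_meas: "G y \<in> borel_measurable S" for y unfolding G_def using \<psi>(1) by simp
  have coeff: "\<bar>\<sigma> l * \<psi> l s\<bar> \<le> 1" if "l \<in> \<Lambda>" "s \<in> space S" for l s
    using \<sigma>[of l] \<psi>(2)[OF that] by (simp add: abs_mult mult_le_one)
  \<comment> \<open>This crude bound serves only as the supremum that multiplies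
    \<open>\<delta>\<close>. It has to be positive, which is why an empty \<open>\<Lambda>\<close>
    is treated apart.\<close>
  have G_le: "\<bar>G y s\<bar> \<le> card \<Lambda>" if "y \<in> cube d" "s \<in> space S" for y s
  proof -
    have "\<bar>G y s\<bar> \<le> (\<Sum>l\<in>\<Lambda>. \<bar>\<sigma> l * \<psi> l s * prod y l\<bar>)" unfolding G_def by (rule sum_abs)
    also have "\<dots> \<le> (\<Sum>l\<in>\<Lambda>. 1)"
      using coeff that \<Lambda>(2) by (intro sum_mono) (simp add: abs_mult[of "_ * _" "prod _ _"] abs_character)
    finally show ?thesis by simp
  qed
  have intG: "integrable (h y0) (G y)" for y
    unfolding G_def using int\<psi>[OF y0] by simp
  have "(\<Sum>l\<in>\<Lambda>. \<bar>\<Sum>y\<in>cube d. prod y l * integral\<^sup>L (h y) (\<psi> l)\<bar>)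
      = (\<Sum>l\<in>\<Lambda>. \<sigma> l * (\<Sum>y\<in>cube d. prod y l * integral\<^sup>L (h y) (\<psi> l)))"
    unfolding \<sigma>_def by (simp add: abs_sgn mult.commute)
  also have "\<dots> = (\<Sum>y\<in>cube d. \<Sum>l\<in>\<Lambda>. \<sigma> l * integral\<^sup>L (h y) (\<psi> l) * prod y l)"
    by (subst sum.swap) (simp add: sum_distrib_left mult_ac)
  also have "\<dots> = (\<Sum>y\<in>cube d. integral\<^sup>L (h y) (G y))"
    unfolding G_def using int\<psi> by (intro sum.cong refl) (simp add: Bochner_Integration.integral_sum)
  also have "\<dots> \<le> (\<Sum>y\<in>cube d. integral\<^sup>L (h y0) (G y) + (exp \<epsilon> - 1) * (\<integral>s. \<bar>G y s\<bar> \<partial>h y0) + 2 * \<delta> * card \<Lambda>)"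
  proof (intro sum_mono)
    fix y assume y: "y \<in> cube d"
    show "integral\<^sup>L (h y) (G y)
      \<le> integral\<^sup>L (h y0) (G y) + (exp \<epsilon> - 1) * (\<integral>s. \<bar>G y s\<bar> \<partial>h y0) + 2 * \<delta> * card \<Lambda>"
      using y y0 sets[OF y] sets[OF y0] sp[OF y] \<open>0 \<le> \<epsilon>\<close> \<open>0 \<le> \<delta>\<close> False \<Lambda>(1) G_meas[of y]
      by (intro integral_le_integral_of_dp prob dp)
        (auto simp: G_le card_gt_0_iff cong: measurable_cong_sets)
  qed
  also have "\<dots> = (\<Sum>y\<in>cube d. integral\<^sup>L (h y0) (G y))
      + (exp \<epsilon> - 1) * (\<Sum>y\<in>cube d. \<integral>s. \<bar>G y s\<bar> \<partial>h y0) + 2 ^ d * (2 * \<delta> * card \<Lambda>)"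
    by (simp add: sum.distrib sum_distrib_left)
  also have "(\<Sum>y\<in>cube d. integral\<^sup>L (h y0) (G y)) = (\<integral>s. (\<Sum>y\<in>cube d. G y s) \<partial>h y0)"
    using intG by simp
  \<comment> \<open>For fixed \<open>s\<close> the coefficients
    \<open>\<sigma> l * \<psi> l s\<close> do not depend on \<open>y\<close>, and every nonempty
    character sums to zero, so the reference term vanishes.\<close>
  also have "(\<lambda>s. \<Sum>y\<in>cube d. G y s) = (\<lambda>s. 0)"
  proof
    fix s
    have "(\<Sum>y\<in>cube d. G y s) = (\<Sum>l\<in>\<Lambda>. \<sigma> l * \<psi> l s * (\<Sum>y\<in>cube d. prod y l))"
      unfolding G_def by (subst sum.swap) (simp add: sum_distrib_left)
    also have "\<dots> = (\<Sum>l\<in>\<Lambda>. 0)"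
      using \<Lambda> by (intro sum.cong refl) (metis sum_character mult_zero_right)
    finally show "(\<Sum>y\<in>cube d. G y s) = 0" by simp
  qed
  finally have reduced: "(\<Sum>l\<in>\<Lambda>. \<bar>\<Sum>y\<in>cube d. prod y l * integral\<^sup>L (h y) (\<psi> l)\<bar>)
      \<le> (exp \<epsilon> - 1) * (\<Sum>y\<in>cube d. \<integral>s. \<bar>G y s\<bar> \<partial>h y0) + 2 ^ d * (2 * \<delta> * card \<Lambda>)"
    by simp
  \<comment> \<open>All integrals are now under the single law \<open>h y0\<close>, so the sum over
    \<open>y\<close> can be moved inside. There \<open>s\<close> is fixed and \<open>G\<close> is a
    character polynomial in \<open>y\<close> with constant coefficients.\<close>
  have "(\<Sum>y\<in>cube d. \<integral>s. \<bar>G y s\<bar> \<partial>h y0) = (\<integral>s. (\<Sum>y\<in>cube d. \<bar>G y s\<bar>) \<partial>h y0)"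
    using intG by simp
  also have "\<dots> \<le> (\<integral>s. 2 ^ d * sqrt (card \<Lambda>) \<partial>h y0)"
  proof (rule integral_mono)
    fix s assume "s \<in> space (h y0)"
    then show "(\<Sum>y\<in>cube d. \<bar>G y s\<bar>) \<le> 2 ^ d * sqrt (card \<Lambda>)"
      unfolding G_def using \<Lambda> coeff sp[OF y0]
      by (intro sum_abs_character_polynomial_le[where c="\<lambda>l. \<sigma> l * \<psi> l s"]) auto
  qed (use intG in \<open>auto intro!: finite_measure.integrable_const prob_space.finite_measure prob y0\<close>)
  also have "\<dots> = 2 ^ d * sqrt (card \<Lambda>)"
    using prob_space.prob_space[OF prob[OF y0]] by simp
  finally have "(exp \<epsilon> - 1) * (\<Sum>y\<in>cube d. \<integral>s. \<bar>G y s\<bar> \<partial>h y0)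
      \<le> (exp \<epsilon> - 1) * (2 ^ d * sqrt (card \<Lambda>))"
    using \<open>0 \<le> \<epsilon>\<close> by (intro mult_left_mono) auto
  with reduced show ?thesis by (simp add: algebra_simps)
qed simp

section \<open>Expectations over product streams\<close>

text \<open>A finite sum with an arbitrary real weight \<open>q\<close> instead of an integral, so
  that linearity and telescoping are plain algebra. For \<open>t = 0\<close> the only stream is the
  empty one, with weight 1.\<close>

definition stream_avg :: "'a set \<Rightarrow> ('a \<Rightarrow> real) \<Rightarrow> nat \<Rightarrow> ((nat \<Rightarrow> 'a) \<Rightarrow> real) \<Rightarrow> real" where
  "stream_avg \<Omega> q t G = (\<Sum>x\<in>{1..t} \<rightarrow>\<^sub>E \<Omega>. (\<Prod>i=1..t. q (x i)) * G x)"

lemma stream_avg_Suc: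
  "stream_avg \<Omega> q (Suc t) G = stream_avg \<Omega> q t (\<lambda>x. \<Sum>y\<in>\<Omega>. q y * G (x(Suc t := y)))"
proof -
  have I: "{1..Suc t} = insert (Suc t) {1..t}" by auto
  have "stream_avg \<Omega> q (Suc t) G
      = (\<Sum>(y, x)\<in>\<Omega> \<times> ({1..t} \<rightarrow>\<^sub>E \<Omega>). (\<Prod>i=1..Suc t. q ((x(Suc t := y)) i)) * G (x(Suc t := y)))"
    unfolding stream_avg_def I PiE_insert_eq
    by (subst sum.reindex) (auto intro!: inj_combinator sum.cong)
  also have "\<dots> = (\<Sum>(y, x)\<in>\<Omega> \<times> ({1..t} \<rightarrow>\<^sub>E \<Omega>). (\<Prod>i=1..t. q (x i)) * (q y * G (x(Suc t := y))))"
    by (intro sum.cong) auto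
  also have "\<dots> = stream_avg \<Omega> q t (\<lambda>x. \<Sum>y\<in>\<Omega>. q y * G (x(Suc t := y)))"
    unfolding stream_avg_def by (simp add: sum.cartesian_product[symmetric] sum.swap[of _ \<Omega>] sum_distrib_left)
  finally show ?thesis .
qed

lemma stream_avg_diff: "stream_avg \<Omega> q t (\<lambda>x. F x - G x) = stream_avg \<Omega> q t F - stream_avg \<Omega> q t G"
  by (simp add: stream_avg_def right_diff_distrib sum_subtractf)

lemma stream_avg_cong:
  "(\<And>x. x \<in> {1..t} \<rightarrow>\<^sub>E \<Omega> \<Longrightarrow> F x = G x) \<Longrightarrow> stream_avg \<Omega> q t F = stream_avg \<Omega> q t G"
  by (simp add: stream_avg_def)

lemma prod_weights_nonneg:
  fixes q :: "'a \<Rightarrow> real"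
  assumes "\<And>y. y \<in> \<Omega> \<Longrightarrow> 0 \<le> q y" "x \<in> {1..t} \<rightarrow>\<^sub>E \<Omega>"
  shows "0 \<le> (\<Prod>i=1..t. q (x i))"
  using assms by (intro prod_nonneg) (auto simp: PiE_def Pi_def)

lemma stream_avg_mono:
  assumes "\<And>y. y \<in> \<Omega> \<Longrightarrow> 0 \<le> q y" "\<And>x. x \<in> {1..t} \<rightarrow>\<^sub>E \<Omega> \<Longrightarrow> F x \<le> G x"
  shows "stream_avg \<Omega> q t F \<le> stream_avg \<Omega> q t G"
  unfolding stream_avg_def using assms by (intro sum_mono mult_left_mono prod_weights_nonneg)

lemma stream_avg_sum: "stream_avg \<Omega> q t (\<lambda>x. \<Sum>l\<in>\<Lambda>. F l x) = (\<Sum>l\<in>\<Lambda>. stream_avg \<Omega> q t (F l))"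
  unfolding stream_avg_def by (simp add: sum_distrib_left sum.swap[of _ \<Lambda>])

lemma stream_avg_const:
  assumes "finite \<Omega>" "sum q \<Omega> = 1"
  shows "stream_avg \<Omega> q t (\<lambda>_. c) = c"
  using assms by (induction t) (simp_all add: stream_avg_Suc sum_distrib_right[symmetric], simp add: stream_avg_def)

lemma abs_stream_avg_le:
  assumes "\<And>y. y \<in> \<Omega> \<Longrightarrow> 0 \<le> q y"
  shows "\<bar>stream_avg \<Omega> q t F\<bar> \<le> stream_avg \<Omega> q t (\<lambda>x. \<bar>F x\<bar>)"
proof -
  have "\<bar>stream_avg \<Omega> q t F\<bar> \<le> (\<Sum>x\<in>{1..t} \<rightarrow>\<^sub>E \<Omega>. \<bar>(\<Prod>i=1..t. q (x i)) * F x\<bar>)"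
    unfolding stream_avg_def by (rule sum_abs)
  also have "\<dots> = stream_avg \<Omega> q t (\<lambda>x. \<bar>F x\<bar>)"
    unfolding stream_avg_def
    by (intro sum.cong refl) (simp only: abs_mult abs_of_nonneg[OF prod_weights_nonneg[of \<Omega> q, OF assms]])
  finally show ?thesis .
qed

text \<open>By \<open>rec\<close>, \<open>V t x\<close> is the value of the prefix \<open>x\<close>
  when the remaining elements come from \<open>p\<close>. Hence
  \<open>stream_avg \<Omega> u t (V t)\<close> belongs to the hybrid with \<open>t\<close> elements
  from \<open>u\<close> followed by elements from \<open>p\<close>, and the difference of the two
  extreme hybrids telescopes.\<close>

lemma stream_avg_hybrid:
  assumes rec: "\<And>t x. t < n \<Longrightarrow> x \<in> {1..t} \<rightarrow>\<^sub>E \<Omega> \<Longrightarrow> V t x = (\<Sum>y\<in>\<Omega>. p y * V (Suc t) (x(Suc t := y)))"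
  shows "stream_avg \<Omega> p n (V n) - stream_avg \<Omega> u n (V n)
    = (\<Sum>t<n. stream_avg \<Omega> u t (\<lambda>x. \<Sum>y\<in>\<Omega>. (p y - u y) * V (Suc t) (x(Suc t := y))))"
proof -
  have step: "stream_avg \<Omega> q t (\<lambda>x. \<Sum>y\<in>\<Omega>. p y * V (Suc t) (x(Suc t := y))) = stream_avg \<Omega> q t (V t)"
    if "t < n" for q t
    using rec[OF that] by (intro stream_avg_cong) simp
  then have "m \<le> n \<Longrightarrow> stream_avg \<Omega> p m (V m) = stream_avg \<Omega> p 0 (V 0)" for m
    by (induction m) (simp_all add: stream_avg_Suc)
  \<comment> \<open>Over the empty prefix the weights are irrelevant, so \<open>p\<close> may be
    exchanged for \<open>u\<close> at time 0.\<close>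
  then have "stream_avg \<Omega> p n (V n) = stream_avg \<Omega> u 0 (V 0)" by (simp add: stream_avg_def)
  then have "stream_avg \<Omega> p n (V n) - stream_avg \<Omega> u n (V n)
      = (\<Sum>t<n. stream_avg \<Omega> u t (V t) - stream_avg \<Omega> u (Suc t) (V (Suc t)))"
    using sum_lessThan_telescope'[of "\<lambda>t. stream_avg \<Omega> u t (V t)" n] by simp
  also have "\<dots> = (\<Sum>t<n. stream_avg \<Omega> u t (\<lambda>x. \<Sum>y\<in>\<Omega>. (p y - u y) * V (Suc t) (x(Suc t := y))))"
    by (intro sum.cong refl)
      (simp add: stream_avg_Suc stream_avg_diff step left_diff_distrib sum_subtractf)
  finally show ?thesis .
qed

section \<open>Runs of an online algorithm\<close>

lemma measure_bind_prob_algebra: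
  assumes "P \<in> space (prob_algebra S)" "K \<in> S \<rightarrow>\<^sub>M prob_algebra R" "A \<in> sets R"
  shows "measure (P \<bind> K) A = (\<integral>s. measure (K s) A \<partial>P)"
proof -
  interpret prob_space P using assms(1) by (simp add: space_prob_algebra)
  have "K \<in> P \<rightarrow>\<^sub>M subprob_algebra R"
    using measurable_prob_algebraD[OF assms(2)] assms(1)
    by (simp add: space_prob_algebra cong: measurable_cong_sets)
  then show ?thesis using assms(3) by (rule measure_bind)
qed

lemma integral_bind_prob_algebra:
  fixes f :: "'a \<Rightarrow> real"
  assumes P: "P \<in> space (prob_algebra S)" and K: "K \<in> S \<rightarrow>\<^sub>M prob_algebra R"
    and f: "f \<in> borel_measurable R" "\<And>x. x \<in> space R \<Longrightarrow> \<bar>f x\<bar> \<le> B"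
  shows "integral\<^sup>L (P \<bind> K) f = (\<integral>s. integral\<^sup>L (K s) f \<partial>P)"
proof (rule integral_bind[OF f])
  show "K \<in> P \<rightarrow>\<^sub>M subprob_algebra R"
    using measurable_prob_algebraD[OF K] P by (simp add: space_prob_algebra cong: measurable_cong_sets)
  show "finite_measure P" using P by (simp add: space_prob_algebra prob_space.finite_measure)
  have "emeasure (K x) (space (K x)) \<le> ennreal 1" if "x \<in> space P" for x
    using measurable_space[OF K, of x] that P
    by (auto simp: space_prob_algebra prob_space.emeasure_space_1 dest: sets_eq_imp_space_eq)
  then show "AE x in P. emeasure (K x) (space (K x)) \<le> ennreal 1" by simp
qed

lemma bind_in_prob_algebra:
  "P \<in> space (prob_algebra S) \<Longrightarrow> K \<in> S \<rightarrow>\<^sub>M prob_algebra R \<Longrightarrow> P \<bind> K \<in> space (prob_algebra R)"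
  by (simp add: space_prob_algebra prob_space_bind' sets_bind')

lemma bind_assoc_prob_algebra:
  assumes "P \<in> space (prob_algebra S)" "K \<in> S \<rightarrow>\<^sub>M prob_algebra R" "L \<in> R \<rightarrow>\<^sub>M prob_algebra T"
  shows "(P \<bind> K) \<bind> L = P \<bind> (\<lambda>s. K s \<bind> L)"
  using assms measurable_prob_algebraD[OF assms(2)]
  by (intro bind_assoc[where N=R and R=T] measurable_prob_algebraD)
    (auto simp: space_prob_algebra cong: measurable_cong_sets)

context
  fixes d n :: nat and M :: "('i, 'o) online_alg"
  assumes M: "online_algorithm d n M"
begin

lemma init_in_prob_algebra: "y \<in> cube d \<Longrightarrow> init_map M y \<in> space (prob_algebra (state_space M))"
  using M by (simp add: online_algorithm_def)

lemma step_kernel: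
  "2 \<le> i \<Longrightarrow> i \<le> n \<Longrightarrow> y \<in> cube d \<Longrightarrow> step_map M i y \<in> state_space M \<rightarrow>\<^sub>M prob_algebra (state_space M)"
  using M by (simp add: online_algorithm_def)

lemma output_kernel: "output_map M \<in> state_space M \<rightarrow>\<^sub>M prob_algebra (output_space M)"
  using M by (simp add: online_algorithm_def)

lemma steps_from_kernel:
  assumes "1 \<le> t" "t + m \<le> n" "\<And>i. i \<in> {t<..t + m} \<Longrightarrow> x i \<in> cube d"
  shows "steps_from M x t m \<in> state_space M \<rightarrow>\<^sub>M prob_algebra (state_space M)"
  using assms(2,3)
proof (induction m)
  case 0
  then show ?case by simp
next
  case (Suc m)
  have "steps_from M x t m \<in> state_space M \<rightarrow>\<^sub>M prob_algebra (state_space M)"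
    by (rule Suc.IH) (use Suc.prems in auto)
  moreover have "step_map M (t + Suc m) (x (t + Suc m)) \<in> state_space M \<rightarrow>\<^sub>M prob_algebra (state_space M)"
    using Suc.prems \<open>1 \<le> t\<close> by (intro step_kernel) auto
  ultimately show ?case by (simp add: measurable_bind_prob_space)
qed

lemma state_after_in_prob_algebra:
  assumes "1 \<le> t" "t \<le> n" "\<And>i. i \<in> {1..t} \<Longrightarrow> x i \<in> cube d"
  shows "state_after M x t \<in> space (prob_algebra (state_space M))"
  unfolding state_after_def using assms
  by (intro bind_in_prob_algebra[OF init_in_prob_algebra] steps_from_kernel) auto

lemma state_after_Suc:
  assumes "1 \<le> t" "t < n" "\<And>i. i \<in> {1..Suc t} \<Longrightarrow> x i \<in> cube d"
  shows "state_after M x (Suc t) = state_after M x t \<bind> step_map M (Suc t) (x (Suc t))"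
proof -
  have "steps_from M x 1 t = (\<lambda>s. steps_from M x 1 (t - 1) s \<bind> step_map M (Suc t) (x (Suc t)))"
    using \<open>1 \<le> t\<close> by (cases t) auto
  then show ?thesis
    unfolding state_after_def using assms
    by (simp, intro bind_assoc_prob_algebra[symmetric, OF init_in_prob_algebra steps_from_kernel step_kernel]) auto
qed

text \<open>Causality: elements not yet read cannot influence the state, so a prefix may be padded
  to a full stream at will.\<close>

lemma state_after_cong:
  assumes "1 \<le> t" "\<And>i. i \<in> {1..t} \<Longrightarrow> x i = x' i"
  shows "state_after M x t = state_after M x' t"
proof -
  have "(\<And>i. i \<in> {1<..1 + m} \<Longrightarrow> x i = x' i) \<Longrightarrow> steps_from M x 1 m s = steps_from M x' 1 m s" for m s
    by (induction m) auto
  from this[of "t - 1"] have "steps_from M x 1 (t - 1) = steps_from M x' 1 (t - 1)"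
    using assms by (intro ext) auto
  then show ?thesis using assms by (simp add: state_after_def)
qed

text \<open>The joint law carries the state \<open>s\<close> along unchanged, so given
  \<open>s\<close> the rectangle has probability \<open>indicator A s\<close>. This extracts from
  pan-privacy the privacy of the intermediate state alone.\<close>

lemma state_output_law_marginal:
  assumes "1 \<le> t" "t \<le> n" "\<And>i. i \<in> {1..n} \<Longrightarrow> x i \<in> cube d" and A: "A \<in> sets (state_space M)"
  shows "measure (state_output_law M n x t) (A \<times> space (output_space M)) = measure (state_after M x t) A"
proof -
  let ?S = "state_space M" and ?O = "output_space M"
  define K where "K = (\<lambda>s. steps_from M x t (n - t) s \<bind> output_map M)"
  have K [measurable]: "K \<in> ?S \<rightarrow>\<^sub>M prob_algebra ?O"
    unfolding K_def using assms
    by (intro measurable_bind_prob_space[OF _ output_kernel] steps_from_kernel) auto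
  let ?J = "\<lambda>s. K s \<bind> (\<lambda>y. return (?S \<Otimes>\<^sub>M ?O) (s, y))"
  have J: "?J \<in> ?S \<rightarrow>\<^sub>M prob_algebra (?S \<Otimes>\<^sub>M ?O)"
    by (rule measurable_bind_prob_space2[OF K]) simp
  have P: "state_after M x t \<in> space (prob_algebra ?S)"
    using assms by (intro state_after_in_prob_algebra) auto
  then have sp: "space (state_after M x t) = space ?S" "sets (state_after M x t) = sets ?S"
    by (auto simp: space_prob_algebra dest: sets_eq_imp_space_eq)
  have "measure (?J s) (A \<times> space ?O) = indicator A s" if s: "s \<in> space ?S" for s
  proof -
    have Ks: "K s \<in> space (prob_algebra ?O)" using measurable_space[OF K s] .
    then interpret Ks: prob_space "K s" by (simp add: space_prob_algebra)
    have spK: "space (K s) = space ?O" using Ks by (auto simp: space_prob_algebra dest: sets_eq_imp_space_eq)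
    have "measure (?J s) (A \<times> space ?O) = (\<integral>y. measure (return (?S \<Otimes>\<^sub>M ?O) (s, y)) (A \<times> space ?O) \<partial>K s)"
      using A s by (intro measure_bind_prob_algebra[OF Ks, where R="?S \<Otimes>\<^sub>M ?O"]) auto
    also have "\<dots> = (\<integral>y. indicator A s \<partial>K s)"
      using A spK by (intro Bochner_Integration.integral_cong) (auto simp: measure_return indicator_def)
    finally show ?thesis by (simp add: Ks.prob_space)
  qed
  then have "(\<integral>s. measure (?J s) (A \<times> space ?O) \<partial>state_after M x t) = (\<integral>s. indicator A s \<partial>state_after M x t)"
    using sp by (intro Bochner_Integration.integral_cong) auto
  then show ?thesis
    using measure_bind_prob_algebra[OF P J, of "A \<times> space ?O"] A sp
      prob_space.finite_measure[of "state_after M x t"] P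
    by (simp add: state_output_law_def K_def)
qed

lemma pan_private_state_dp:
  assumes pan: "pan_private d n \<epsilon> \<delta> M"
    and t: "t < n" and x: "x \<in> {1..t} \<rightarrow>\<^sub>E cube d" and y: "y \<in> cube d" "y' \<in> cube d"
    and A: "A \<in> sets (state_space M)"
  shows "measure (state_after M (x(Suc t := y)) (Suc t)) A
    \<le> exp \<epsilon> * measure (state_after M (x(Suc t := y')) (Suc t)) A + \<delta>"
proof -
  \<comment> \<open>Pan-privacy speaks of streams of length \<open>n\<close>, so the prefix is
    padded by some element of the cube.\<close>
  define z where "z = (\<lambda>v. \<lambda>i\<in>{1..n}. if i \<le> t then x i else v)"
  have z: "z v \<in> streams_of d n" if "v \<in> cube d" for v
    using that x by (auto simp: z_def streams_of_def PiE_def Pi_def)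
  \<comment> \<open>The padding stays that of \<open>z y\<close> for every \<open>v\<close>; two
    such streams can therefore differ only at position \<open>Suc t\<close>.\<close>
  let ?w = "\<lambda>v. (z y)(Suc t := v)"
  have w: "?w v \<in> streams_of d n" if "v \<in> cube d" for v
    using z[OF y(1)] that t by (auto simp: streams_of_def PiE_def Pi_def extensional_def)
  have eq: "state_after M (x(Suc t := v)) (Suc t) = state_after M (?w v) (Suc t)" for v
    using t by (intro state_after_cong) (auto simp: z_def)
  have marg: "measure (state_output_law M n (?w v) (Suc t)) (A \<times> space (output_space M))
      = measure (state_after M (?w v) (Suc t)) A" if "v \<in> cube d" for v
    using w[OF that] t A by (intro state_output_law_marginal) (auto simp: streams_of_def PiE_def Pi_def)
  have "{i\<in>{1..n}. ?w y i \<noteq> ?w y' i} \<subseteq> {Suc t}" by auto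
  then have "neighbors n (?w y) (?w y')"
    unfolding neighbors_def by (metis card_mono finite.emptyI finite.insertI is_singletonI is_singleton_altdef)
  then show ?thesis
    using pan w[OF y(1)] w[OF y(2)] t A unfolding pan_private_def eq marg[OF y(1), symmetric] marg[OF y(2), symmetric]
    by auto
qed

text \<open>Probability that the output lands in \<open>A\<close> when \<open>m\<close> elements, drawn independently from the
  mass function \<open>q\<close>, remain to be read in state \<open>s\<close>.\<close>

primrec continuation :: "((nat \<Rightarrow> real) \<Rightarrow> real) \<Rightarrow> 'o set \<Rightarrow> nat \<Rightarrow> 'i \<Rightarrow> real" where
  "continuation q A 0 s = measure (output_map M s) A"
| "continuation q A (Suc m) s =
    (\<Sum>y\<in>cube d. q y * (\<integral>s'. continuation q A m s' \<partial>step_map M (n - m) y s))"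

context
  fixes q :: "(nat \<Rightarrow> real) \<Rightarrow> real" and A :: "'o set"
  assumes q: "\<And>y. y \<in> cube d \<Longrightarrow> 0 \<le> q y" "sum q (cube d) = 1" and A: "A \<in> sets (output_space M)"
begin

text \<open>Measurability and boundedness are proved in one induction, since the integrals at
  \<open>Suc m\<close> need both at \<open>m\<close>. The restriction \<open>m < n\<close> keeps the
  index \<open>n - m\<close> of the inductive step at least 2: the first element is read by
  \<open>init_map\<close>, not by a step kernel.\<close>

lemma continuation_bounds:
  assumes "m < n"
  shows "continuation q A m \<in> borel_measurable (state_space M)"
    and "s \<in> space (state_space M) \<Longrightarrow> \<bar>continuation q A m s\<bar> \<le> 1"
proof -
  have "continuation q A m \<in> borel_measurable (state_space M)
      \<and> (\<forall>s\<in>space (state_space M). \<bar>continuation q A m s\<bar> \<le> 1)"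
    using assms
  proof (induction m)
    case 0
    have "\<bar>measure (output_map M s) A\<bar> \<le> 1" if "s \<in> space (state_space M)" for s
      using measurable_space[OF output_kernel that]
      by (simp add: space_prob_algebra prob_space.prob_le_1)
    moreover have "(\<lambda>s. measure (output_map M s) A) \<in> borel_measurable (state_space M)"
      using A by (intro measurable_compose[OF output_kernel] measurable_measure_prob_algebra)
    ultimately show ?case by auto
  next
    case (Suc m)
    then have meas: "continuation q A m \<in> borel_measurable (state_space M)"
      and le: "s \<in> space (state_space M) \<Longrightarrow> \<bar>continuation q A m s\<bar> \<le> 1" for s by auto
    have step: "step_map M (n - m) y \<in> state_space M \<rightarrow>\<^sub>M prob_algebra (state_space M)" if "y \<in> cube d" for y
      using Suc.prems that by (intro step_kernel) auto
    have "(\<lambda>s. \<integral>s'. continuation q A m s' \<partial>step_map M (n - m) y s) \<in> borel_measurable (state_space M)"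
      if "y \<in> cube d" for y
      by (rule measurable_compose[OF measurable_prob_algebraD[OF step[OF that]]
            integral_measurable_subprob_algebra[OF meas]])
    then have "(\<lambda>s. continuation q A (Suc m) s) \<in> borel_measurable (state_space M)"
      unfolding continuation.simps by (intro borel_measurable_sum borel_measurable_times) auto
    moreover have "\<bar>continuation q A (Suc m) s\<bar> \<le> 1" if s: "s \<in> space (state_space M)" for s
    proof -
      have "\<bar>continuation q A (Suc m) s\<bar>
          \<le> (\<Sum>y\<in>cube d. \<bar>q y * (\<integral>s'. continuation q A m s' \<partial>step_map M (n - m) y s)\<bar>)"
        by (simp add: sum_abs)
      also have "\<dots> \<le> (\<Sum>y\<in>cube d. q y * 1)"
      proof (rule sum_mono)
        fix y assume y: "y \<in> cube d"
        have "step_map M (n - m) y s \<in> space (prob_algebra (state_space M))"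
          using measurable_space[OF step[OF y] s] .
        from abs_integral_prob_algebra_le[OF this meas le]
        show "\<bar>q y * (\<integral>s'. continuation q A m s' \<partial>step_map M (n - m) y s)\<bar> \<le> q y * 1"
          using q(1)[OF y] by (simp add: abs_mult mult_left_le)
      qed
      also have "\<dots> = 1" using q(2) by simp
      finally show ?thesis .
    qed
    ultimately show ?case by blast
  qed
  then show "continuation q A m \<in> borel_measurable (state_space M)"
    and "s \<in> space (state_space M) \<Longrightarrow> \<bar>continuation q A m s\<bar> \<le> 1" by auto
qed

text \<open>At time \<open>0\<close> there is no state, so the value is obtained by averaging over the first element.\<close>

definition prefix_value :: "nat \<Rightarrow> (nat \<Rightarrow> nat \<Rightarrow> real) \<Rightarrow> real" where
  "prefix_value t x =
    (if t = 0 then \<Sum>y\<in>cube d. q y * integral\<^sup>L (state_after M (x(1 := y)) 1) (continuation q A (n - 1))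
     else integral\<^sup>L (state_after M x t) (continuation q A (n - t)))"

text \<open>The tower property: conditioning on one more element drawn from \<open>q\<close>. At
  time 0 it is the definition; later the state law at \<open>Suc t\<close> is the law at
  \<open>t\<close> pushed through the step kernel, so the integral unfolds along the bind. This is
  the recursion required by the hybrid argument.\<close>

lemma prefix_value_step:
  assumes "t < n" and x: "x \<in> {1..t} \<rightarrow>\<^sub>E cube d"
  shows "prefix_value t x = (\<Sum>y\<in>cube d. q y * prefix_value (Suc t) (x(Suc t := y)))"
proof (cases "t = 0")
  case True
  then show ?thesis by (simp add: prefix_value_def)
next
  case False
  then have t: "1 \<le> t" by simp
  define m where "m = n - Suc t"
  \<comment> \<open>After \<open>t\<close> elements \<open>Suc m\<close> remain, and the next one,
    which \<open>continuation\<close> addresses as number \<open>n - m\<close>, is indeed number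
    \<open>Suc t\<close>.\<close>
  have m: "n - t = Suc m" "n - m = Suc t" "m < n" using \<open>t < n\<close> t by (auto simp: m_def)
  have P: "state_after M x t \<in> space (prob_algebra (state_space M))"
    using x t \<open>t < n\<close> by (intro state_after_in_prob_algebra) (auto simp: PiE_def Pi_def)
  have step: "step_map M (Suc t) y \<in> state_space M \<rightarrow>\<^sub>M prob_algebra (state_space M)" if "y \<in> cube d" for y
    using t \<open>t < n\<close> that by (intro step_kernel) auto
  let ?f = "\<lambda>y s. \<integral>s'. continuation q A m s' \<partial>step_map M (Suc t) y s"
  have int: "integrable (state_after M x t) (?f y)" if y: "y \<in> cube d" for y
  proof (rule integrable_prob_algebra[OF P])
    show "?f y \<in> borel_measurable (state_space M)"
      by (rule measurable_compose[OF measurable_prob_algebraD[OF step[OF y]]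
            integral_measurable_subprob_algebra[OF continuation_bounds(1)[OF m(3)]]])
    show "\<bar>?f y s\<bar> \<le> 1" if "s \<in> space (state_space M)" for s
      using measurable_space[OF step[OF y] that]
      by (rule abs_integral_prob_algebra_le[OF _ continuation_bounds[OF m(3)]])
  qed
  have "prefix_value t x = (\<integral>s. (\<Sum>y\<in>cube d. q y * ?f y s) \<partial>state_after M x t)"
    using False by (simp add: prefix_value_def m continuation.simps(2)[of q A m, THEN ext])
  also have "\<dots> = (\<Sum>y\<in>cube d. q y * (\<integral>s. ?f y s \<partial>state_after M x t))"
    using int by (simp add: Bochner_Integration.integral_sum)
  also have "\<dots> = (\<Sum>y\<in>cube d. q y * prefix_value (Suc t) (x(Suc t := y)))"
  proof (intro sum.cong refl)
    fix y assume y: "y \<in> cube d"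
    have "state_after M (x(Suc t := y)) (Suc t) = state_after M (x(Suc t := y)) t \<bind> step_map M (Suc t) y"
      using t \<open>t < n\<close> x y by (subst state_after_Suc) (auto simp: PiE_def Pi_def)
    also have "state_after M (x(Suc t := y)) t = state_after M x t"
      using t by (intro state_after_cong) auto
    finally have "prefix_value (Suc t) (x(Suc t := y))
        = integral\<^sup>L (state_after M x t \<bind> step_map M (Suc t) y) (continuation q A m)"
      unfolding prefix_value_def m_def by (simp only: nat.distinct if_False)
    also have "\<dots> = (\<integral>s. ?f y s \<partial>state_after M x t)"
      by (rule integral_bind_prob_algebra[OF P step[OF y] continuation_bounds[OF m(3)]])
    finally show "q y * (\<integral>s. ?f y s \<partial>state_after M x t) = q y * prefix_value (Suc t) (x(Suc t := y))" by simp
  qed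
  finally show ?thesis .
qed

lemma prefix_value_final:
  assumes "1 \<le> n" "x \<in> streams_of d n"
  shows "prefix_value n x = measure (run_alg M n x) A"
proof -
  have "state_after M x n \<in> space (prob_algebra (state_space M))"
    using assms by (intro state_after_in_prob_algebra) (auto simp: streams_of_def PiE_def Pi_def)
  from measure_bind_prob_algebra[OF this output_kernel A] show ?thesis
    using assms(1) by (simp add: prefix_value_def run_alg_def continuation.simps(1)[of q A, THEN ext])
qed

end

end

section \<open>Discrete sources\<close>

lemma integral_finite_discrete:
  fixes f :: "'a \<Rightarrow> real"
  assumes "finite \<Omega>" "sets D = Pow \<Omega>" "finite_measure D"
  shows "integral\<^sup>L D f = (\<Sum>x\<in>\<Omega>. measure D {x} * f x)"
proof -
  interpret finite_measure D by fact
  have "D = point_measure \<Omega> (\<lambda>x. ennreal (measure D {x}))"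
    by (rule measure_eqI_finite[OF assms(2) _ assms(1)])
      (use assms in \<open>auto simp: sets_point_measure emeasure_point_measure_finite emeasure_eq_measure\<close>)
  then have "integral\<^sup>L D f = integral\<^sup>L (point_measure \<Omega> (\<lambda>x. ennreal (measure D {x}))) f" by simp
  also have "\<dots> = (\<Sum>x\<in>\<Omega>. measure D {x} * f x)"
    using assms(1) by (simp add: lebesgue_integral_point_measure_finite)
  finally show ?thesis .
qed

text \<open>Finiteness of \<open>\<Omega>\<close> makes the product sigma-algebra the full power
  set. The law of the stream is then determined by its point masses, which are the weights used in
  \<open>stream_avg\<close>.\<close>

lemma
  assumes "finite \<Omega>" "sets D = Pow \<Omega>" "prob_space D"
  shows sets_iid_discrete: "sets (iid n D) = Pow ({1..n} \<rightarrow>\<^sub>E \<Omega>)"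
    and prob_space_iid_discrete: "prob_space (iid n D)"
    and measure_iid_discrete: "x \<in> {1..n} \<rightarrow>\<^sub>E \<Omega> \<Longrightarrow> measure (iid n D) {x} = (\<Prod>i=1..n. measure D {x i})"
proof -
  interpret D: prob_space D by fact
  interpret finite_product_prob_space "\<lambda>_. D" "{1..n}" by standard auto
  have "sets (iid n D) = sets (\<Pi>\<^sub>M i\<in>{1..n}. count_space \<Omega>)"
    unfolding iid_def using assms(2) by (intro sets_PiM_cong) auto
  also have "(\<Pi>\<^sub>M i\<in>{1..n}. count_space \<Omega>) = count_space ({1..n} \<rightarrow>\<^sub>E \<Omega>)"
    using assms(1) by (intro count_space_PiM_finite) (auto intro: countable_finite)
  finally show "sets (iid n D) = Pow ({1..n} \<rightarrow>\<^sub>E \<Omega>)" by simp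
  show "prob_space (iid n D)" unfolding iid_def by (rule prob_space_PiM) (rule assms(3))
  assume x: "x \<in> {1..n} \<rightarrow>\<^sub>E \<Omega>"
  then have "{x} = (\<Pi>\<^sub>E i\<in>{1..n}. {x i})" by (simp add: PiE_iff PiE_singleton)
  moreover have "measure (iid n D) (\<Pi>\<^sub>E i\<in>{1..n}. {x i}) = (\<Prod>i=1..n. measure D {x i})"
    unfolding iid_def using x assms(2) by (intro prob_times) auto
  ultimately show "measure (iid n D) {x} = (\<Prod>i=1..n. measure D {x i})" by simp
qed

lemma finite_streams_of [simp]: "finite (streams_of d n)"
  by (auto simp: streams_of_def intro!: finite_PiE)

lemma unif_dist_discrete:
  "sets (unif_dist d) = Pow (cube d)" "prob_space (unif_dist d)"
  "y \<in> cube d \<Longrightarrow> measure (unif_dist d) {y} = 1 / 2 ^ d"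
  by (simp_all add: unif_dist_def sets_uniform_count_measure prob_space_uniform_count_measure
      measure_uniform_count_measure)

text \<open>The mass function of \<open>parity_dist\<close> before the cast to
  \<open>ennreal\<close>, so that differences with the uniform mass make sense. As it is nonnegative
  for \<open>\<alpha> < 1 / 2\<close>, the cast truncates nothing.\<close>

definition parity_mass :: "nat \<Rightarrow> nat set \<Rightarrow> real \<Rightarrow> real \<Rightarrow> (nat \<Rightarrow> real) \<Rightarrow> real" where
  "parity_mass d l b \<alpha> y = (1 + 2 * \<alpha> * b * prod y l) / 2 ^ d"

lemma parity_mass_nonneg:
  assumes "l \<subseteq> {1..d}" "\<bar>b\<bar> = 1" "0 < \<alpha>" "\<alpha> < 1 / 2" "y \<in> cube d"
  shows "0 \<le> parity_mass d l b \<alpha> y"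
proof -
  have "\<bar>2 * \<alpha> * b * prod y l\<bar> \<le> 1" using assms by (simp add: abs_mult abs_character)
  then show ?thesis by (simp add: parity_mass_def)
qed

lemma sum_parity_mass:
  assumes "l \<subseteq> {1..d}" "l \<noteq> {}"
  shows "sum (parity_mass d l b \<alpha>) (cube d) = 1"
  using sum_character[OF assms]
  by (simp add: parity_mass_def add_divide_distrib sum.distrib sum_divide_distrib[symmetric] sum_distrib_left[symmetric])

lemma parity_dist_discrete:
  assumes l: "l \<subseteq> {1..d}" "l \<noteq> {}" and b: "\<bar>b\<bar> = 1" and \<alpha>: "0 < \<alpha>" "\<alpha> < 1 / 2"
  shows "sets (parity_dist d l b \<alpha>) = Pow (cube d)"
    and "prob_space (parity_dist d l b \<alpha>)"
    and "y \<in> cube d \<Longrightarrow> measure (parity_dist d l b \<alpha>) {y} = parity_mass d l b \<alpha> y"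
proof -
  note nonneg = parity_mass_nonneg[OF l(1) b \<alpha>]
  have eq: "parity_dist d l b \<alpha> = point_measure (cube d) (\<lambda>y. ennreal (parity_mass d l b \<alpha> y))"
    by (simp add: parity_dist_def parity_mass_def)
  show "sets (parity_dist d l b \<alpha>) = Pow (cube d)" by (simp add: eq sets_point_measure)
  have em: "emeasure (parity_dist d l b \<alpha>) X = ennreal (sum (parity_mass d l b \<alpha>) X)" if "X \<subseteq> cube d" for X
    using that nonneg by (simp add: eq emeasure_point_measure_finite subset_iff sum_ennreal)
  show "prob_space (parity_dist d l b \<alpha>)"
    by standard (simp add: em[of "cube d"] sum_parity_mass[OF l] eq[THEN arg_cong[of _ _ space]] space_point_measure)
  show "measure (parity_dist d l b \<alpha>) {y} = parity_mass d l b \<alpha> y" if "y \<in> cube d"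
    using em[of "{y}"] that nonneg[OF that] by (simp add: measure_def)
qed

section \<open>The family of parities and its size\<close>

definition parity_sets :: "nat \<Rightarrow> nat \<Rightarrow> nat set set" where
  "parity_sets d k = {l. l \<subseteq> {1..d} \<and> 1 \<le> card l \<and> card l \<le> k}"

lemma finite_parity_sets [simp]: "finite (parity_sets d k)"
  by (rule finite_subset[of _ "Pow {1..d}"]) (auto simp: parity_sets_def)

lemma card_parity_sets: "card (parity_sets d k) = binom_le d k"
proof -
  have "parity_sets d k = (\<Union>j\<in>{1..k}. {l. l \<subseteq> {1..d} \<and> card l = j})"
    by (auto simp: parity_sets_def)
  also have "card \<dots> = (\<Sum>j=1..k. card {l. l \<subseteq> {1..d} \<and> card l = j})"
    by (rule card_UN_disjoint) auto
  also have "\<dots> = binom_le d k" by (simp add: binom_le_def n_subsets)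
  finally show ?thesis .
qed

lemma parity_params_eq: "parity_params d k = parity_sets d k \<times> {-1, 1}"
  by (auto simp: parity_params_def parity_sets_def)

text \<open>The summand for \<open>j = 1\<close> is \<open>d\<close>. Hence the family is nonempty
  when \<open>1 \<le> d\<close>, and its size is at least 2 once \<open>d \<ge> 2\<close>.\<close>

lemma binom_le_ge: "1 \<le> k \<Longrightarrow> d \<le> binom_le d k"
  using sum_mono2[of "{1..k}" "{1}" "\<lambda>j. d choose j"] by (simp add: binom_le_def)

lemma iid_parity_kernel:
  assumes \<alpha>: "0 < \<alpha>" "\<alpha> < 1 / 2" and l: "l \<in> parity_sets d k" and b: "b \<in> {-1, 1}"
  shows "iid n (parity_dist d l b \<alpha>) \<in> space (prob_algebra (count_space (streams_of d n)))"
proof -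
  have "l \<subseteq> {1..d}" "l \<noteq> {}" "\<bar>b\<bar> = 1" using l b by (auto simp: parity_sets_def)
  note D = parity_dist_discrete[OF this \<alpha>]
  show ?thesis
    using sets_iid_discrete[OF finite_cube D(1,2), of n] prob_space_iid_discrete[OF finite_cube D(1,2), of n]
    by (simp add: space_prob_algebra streams_of_def)
qed

section \<open>Output laws as finite averages, and the total variation bound\<close>

context
  fixes d n :: nat and M :: "('i, 'o) online_alg"
  assumes M: "online_algorithm d n M" and n: "1 \<le> n"
begin

lemma run_alg_kernel: "run_alg M n \<in> count_space (streams_of d n) \<rightarrow>\<^sub>M prob_algebra (output_space M)"
proof -
  have "run_alg M n x \<in> space (prob_algebra (output_space M))" if "x \<in> streams_of d n" for x
    unfolding run_alg_def using that n
    by (intro bind_in_prob_algebra[OF state_after_in_prob_algebra[OF M] output_kernel[OF M]])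
      (auto simp: streams_of_def PiE_def Pi_def)
  then show ?thesis by auto
qed

lemma measure_output_dist_iid:
  assumes D: "sets D = Pow (cube d)" "prob_space D" "\<And>y. y \<in> cube d \<Longrightarrow> measure D {y} = q y"
    and A: "A \<in> sets (output_space M)"
  shows "measure (output_dist M n (iid n D)) A = stream_avg (cube d) q n (\<lambda>x. measure (run_alg M n x) A)"
proof -
  have sets: "sets (iid n D) = Pow (streams_of d n)" and prob: "prob_space (iid n D)"
    using sets_iid_discrete[OF finite_cube D(1,2), of n] prob_space_iid_discrete[OF finite_cube D(1,2), of n]
    by (simp_all add: streams_of_def)
  then have "iid n D \<in> space (prob_algebra (count_space (streams_of d n)))"
    by (simp add: space_prob_algebra)
  from measure_bind_prob_algebra[OF this run_alg_kernel A]
  have "measure (output_dist M n (iid n D)) A = (\<integral>x. measure (run_alg M n x) A \<partial>iid n D)"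
    by (simp add: output_dist_def)
  also have "\<dots> = (\<Sum>x\<in>streams_of d n. measure (iid n D) {x} * measure (run_alg M n x) A)"
    using sets prob by (intro integral_finite_discrete) (auto intro: prob_space.finite_measure)
  also have "\<dots> = (\<Sum>x\<in>streams_of d n. (\<Prod>i=1..n. q (x i)) * measure (run_alg M n x) A)"
    using D by (intro sum.cong refl arg_cong2[where f="(*)"])
      (auto simp: streams_of_def measure_iid_discrete[of "cube d"] PiE_def Pi_def intro!: prod.cong)
  finally show ?thesis by (simp add: stream_avg_def streams_of_def)
qed

lemma
  assumes k: "1 \<le> k" "k \<le> d" and \<alpha>: "0 < \<alpha>" "\<alpha> < 1 / 2"
  shows sets_output_dist_mixture:
      "sets (output_dist M n (parity_mixture_iid d k \<alpha> n)) = sets (output_space M)"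
    and measure_output_dist_mixture:
      "A \<in> sets (output_space M) \<Longrightarrow> measure (output_dist M n (parity_mixture_iid d k \<alpha> n)) A
        = (\<Sum>l\<in>parity_sets d k. \<Sum>b\<in>{-1, 1}.
            stream_avg (cube d) (parity_mass d l b \<alpha>) n (\<lambda>x. measure (run_alg M n x) A))
          / (2 * real (binom_le d k))"
proof -
  let ?\<Theta> = "parity_params d k" and ?K = "\<lambda>(l, b). iid n (parity_dist d l b \<alpha>)"
  have card: "card ?\<Theta> = 2 * binom_le d k"
    by (simp add: parity_params_eq card_cartesian_product card_parity_sets)
  have fin: "finite ?\<Theta>" by (simp add: parity_params_eq)
  have "?\<Theta> \<noteq> {}" using card binom_le_ge[OF k(1), of d] k by auto
  then have U: "uniform_count_measure ?\<Theta> \<in> space (prob_algebra (count_space ?\<Theta>))"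
    using fin by (simp add: space_prob_algebra sets_uniform_count_measure prob_space_uniform_count_measure)
  have K: "?K \<in> count_space ?\<Theta> \<rightarrow>\<^sub>M prob_algebra (count_space (streams_of d n))"
    using iid_parity_kernel[OF \<alpha>] by (auto simp: parity_params_eq)
  \<comment> \<open>Associativity of bind moves the single draw of \<open>(l, b)\<close> to the
    outside, so the output law is a uniform mixture of the laws for fixed parameters.\<close>
  have mix: "output_dist M n (parity_mixture_iid d k \<alpha> n)
      = uniform_count_measure ?\<Theta> \<bind> (\<lambda>\<theta>. output_dist M n (?K \<theta>))"
    unfolding output_dist_def parity_mixture_iid_def by (rule bind_assoc_prob_algebra[OF U K run_alg_kernel])
  have KR: "(\<lambda>\<theta>. output_dist M n (?K \<theta>)) \<in> count_space ?\<Theta> \<rightarrow>\<^sub>M prob_algebra (output_space M)"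
    unfolding output_dist_def by (rule measurable_bind_prob_space[OF K run_alg_kernel])
  show "sets (output_dist M n (parity_mixture_iid d k \<alpha> n)) = sets (output_space M)"
    unfolding mix by (rule sets_bind'[OF U KR])
  assume A: "A \<in> sets (output_space M)"
  have "measure (output_dist M n (parity_mixture_iid d k \<alpha> n)) A
      = (\<Sum>\<theta>\<in>?\<Theta>. measure (output_dist M n (?K \<theta>)) A) / (2 * real (binom_le d k))"
    unfolding mix measure_bind_prob_algebra[OF U KR A] using fin card
    by (simp add: integral_uniform_count_measure)
  also have "(\<Sum>\<theta>\<in>?\<Theta>. measure (output_dist M n (?K \<theta>)) A) = (\<Sum>l\<in>parity_sets d k. \<Sum>b\<in>{-1, 1}.
      measure (output_dist M n (iid n (parity_dist d l b \<alpha>))) A)"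
    unfolding parity_params_eq by (subst sum.cartesian_product) (auto intro!: sum.cong)
  also have "\<dots> = (\<Sum>l\<in>parity_sets d k. \<Sum>b\<in>{-1, 1}.
      stream_avg (cube d) (parity_mass d l b \<alpha>) n (\<lambda>x. measure (run_alg M n x) A))"
  proof (intro sum.cong refl)
    fix l b assume lb: "l \<in> parity_sets d k" "b \<in> {-1, 1::real}"
    then have "l \<subseteq> {1..d}" "l \<noteq> {}" "\<bar>b\<bar> = 1" by (auto simp: parity_sets_def)
    note D = parity_dist_discrete[OF this \<alpha>]
    show "measure (output_dist M n (iid n (parity_dist d l b \<alpha>))) A
        = stream_avg (cube d) (parity_mass d l b \<alpha>) n (\<lambda>x. measure (run_alg M n x) A)"
      by (rule measure_output_dist_iid[OF D A])
  qed
  finally show "measure (output_dist M n (parity_mixture_iid d k \<alpha> n)) A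
      = (\<Sum>l\<in>parity_sets d k. \<Sum>b\<in>{-1, 1}.
          stream_avg (cube d) (parity_mass d l b \<alpha>) n (\<lambda>x. measure (run_alg M n x) A))
        / (2 * real (binom_le d k))" .
qed

text \<open>The hybrid argument writes each summand as a sum over time of correlations between the
  state law and the \<open>l\<close>-th character, tested against the continuation for
  \<open>l\<close>. For a fixed prefix the map from the next element to the state is one private
  channel, common to all \<open>l\<close>, so the correlation bound controls the whole sum over
  \<open>l\<close>.\<close>

lemma sum_parity_advantage_le:
  fixes k :: nat
  assumes pan: "pan_private d n \<epsilon> \<delta> M" and "0 \<le> \<epsilon>" "0 \<le> \<delta>"
    and \<alpha>: "0 < \<alpha>" "\<alpha> < 1 / 2" and b: "\<bar>b\<bar> = 1" and A: "A \<in> sets (output_space M)"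
  defines "F \<equiv> \<lambda>x. measure (run_alg M n x) A" and "N \<equiv> real (binom_le d k)"
  shows "(\<Sum>l\<in>parity_sets d k. \<bar>stream_avg (cube d) (parity_mass d l b \<alpha>) n F
      - stream_avg (cube d) (\<lambda>_. 1 / 2 ^ d) n F\<bar>)
    \<le> n * (2 * \<alpha> * ((exp \<epsilon> - 1) * sqrt N + 2 * \<delta> * N))"
proof -
  let ?\<Lambda> = "parity_sets d k" and ?u = "\<lambda>_. 1 / 2 ^ d :: real"
  let ?p = "\<lambda>l. parity_mass d l b \<alpha>"
  have \<Lambda>: "l \<subseteq> {1..d}" "l \<noteq> {}" if "l \<in> ?\<Lambda>" for l
    using that by (auto simp: parity_sets_def)
  have p: "0 \<le> ?p l y" if "l \<in> ?\<Lambda>" "y \<in> cube d" for l y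
    using parity_mass_nonneg \<Lambda>[OF that(1)] b \<alpha> that(2) by blast
  have sum_p: "sum (?p l) (cube d) = 1" if "l \<in> ?\<Lambda>" for l
    using sum_parity_mass \<Lambda>[OF that] by blast
  define c where "c = (\<lambda>l t x. \<bar>\<Sum>y\<in>cube d. prod y l
      * integral\<^sup>L (state_after M (x(Suc t := y)) (Suc t)) (continuation d n M (?p l) A (n - Suc t))\<bar>)"
  have diff: "\<bar>stream_avg (cube d) (?p l) n F - stream_avg (cube d) ?u n F\<bar>
      \<le> (\<Sum>t<n. stream_avg (cube d) ?u t (\<lambda>x. 2 * \<alpha> / 2 ^ d * c l t x))" if l: "l \<in> ?\<Lambda>" for l
  proof -
    let ?V = "prefix_value d n M (?p l) A"
    note pl = p[OF l] sum_p[OF l]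
    have final: "stream_avg (cube d) q n F = stream_avg (cube d) q n (?V n)" for q
      unfolding F_def using prefix_value_final[OF M pl A n]
      by (intro stream_avg_cong) (simp add: streams_of_def)
    let ?D = "\<lambda>t x. \<Sum>y\<in>cube d. (?p l y - 1 / 2 ^ d) * ?V (Suc t) (x(Suc t := y))"
    have hybrid: "stream_avg (cube d) (?p l) n F - stream_avg (cube d) ?u n F
        = (\<Sum>t<n. stream_avg (cube d) ?u t (?D t))"
      unfolding final using prefix_value_step[OF M pl A] by (rule stream_avg_hybrid)
    show ?thesis
      unfolding hybrid
    proof (rule order_trans[OF sum_abs], rule sum_mono)
      fix t
      have "\<bar>?D t x\<bar> = 2 * \<alpha> / 2 ^ d * c l t x" for x
      proof -
        let ?I = "\<lambda>y. integral\<^sup>L (state_after M (x(Suc t := y)) (Suc t)) (continuation d n M (?p l) A (n - Suc t))"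
        have "?V (Suc t) (x(Suc t := y)) = ?I y" for y
          by (rule trans[OF prefix_value_def[OF M pl A]]) simp_all
        \<comment> \<open>The uniform part cancels and leaves a multiple of the character.\<close>
        moreover have "?p l y - 1 / 2 ^ d = 2 * \<alpha> / 2 ^ d * b * prod y l" for y
          by (simp add: parity_mass_def add_divide_distrib)
        ultimately have "?D t x = (2 * \<alpha> / 2 ^ d * b) * (\<Sum>y\<in>cube d. prod y l * ?I y)"
          by (simp only: sum_distrib_left mult.assoc)
        then have "\<bar>?D t x\<bar>
            = \<bar>2 * \<alpha> / 2 ^ d * b\<bar> * c l t x"
          by (simp only: c_def abs_mult)
        then show ?thesis using \<alpha>(1) b by (simp only: abs_mult abs_divide) simp
      qed
      then show "\<bar>stream_avg (cube d) ?u t (?D t)\<bar>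
          \<le> stream_avg (cube d) ?u t (\<lambda>x. 2 * \<alpha> / 2 ^ d * c l t x)"
        by (intro order_trans[OF abs_stream_avg_le] stream_avg_mono) auto
    qed
  qed
  have sum_c: "(\<Sum>l\<in>?\<Lambda>. c l t x) \<le> 2 ^ d * ((exp \<epsilon> - 1) * sqrt N + 2 * \<delta> * N)"
    if t: "t < n" and x: "x \<in> {1..t} \<rightarrow>\<^sub>E cube d" for t x
    unfolding c_def N_def card_parity_sets[symmetric]
  proof (rule sum_dp_character_correlation_le)
    show "state_after M (x(Suc t := y)) (Suc t) \<in> space (prob_algebra (state_space M))" if "y \<in> cube d" for y
      using t x that by (intro state_after_in_prob_algebra[OF M]) (auto simp: PiE_def Pi_def)
    fix y y' B assume "y \<in> cube d" "y' \<in> cube d" "B \<in> sets (state_space M)"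
    then show "measure (state_after M (x(Suc t := y)) (Suc t)) B
        \<le> exp \<epsilon> * measure (state_after M (x(Suc t := y')) (Suc t)) B + \<delta>"
      by (rule pan_private_state_dp[OF M pan t x])
  next
    fix l assume l: "l \<in> ?\<Lambda>"
    note bounds = continuation_bounds[OF M p[OF l] sum_p[OF l] A, of "n - Suc t"]
    show "continuation d n M (?p l) A (n - Suc t) \<in> borel_measurable (state_space M)"
      using t by (intro bounds) auto
    show "\<bar>continuation d n M (?p l) A (n - Suc t) s\<bar> \<le> 1" if "s \<in> space (state_space M)" for s
      using t that by (intro bounds) auto
  qed (use \<Lambda> \<open>0 \<le> \<epsilon>\<close> \<open>0 \<le> \<delta>\<close> in auto)
  have "(\<Sum>l\<in>?\<Lambda>. \<bar>stream_avg (cube d) (?p l) n F - stream_avg (cube d) ?u n F\<bar>)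
      \<le> (\<Sum>l\<in>?\<Lambda>. \<Sum>t<n. stream_avg (cube d) ?u t (\<lambda>x. 2 * \<alpha> / 2 ^ d * c l t x))"
    by (rule sum_mono) (rule diff)
  \<comment> \<open>The prefix is uniform whatever \<open>l\<close> is, so the sum over
    \<open>l\<close> can be taken inside the average over prefixes. This is why the hybrids have
    their uniform elements first.\<close>
  also have "\<dots> = (\<Sum>t<n. stream_avg (cube d) ?u t (\<lambda>x. 2 * \<alpha> / 2 ^ d * (\<Sum>l\<in>?\<Lambda>. c l t x)))"
    by (subst sum.swap) (simp add: stream_avg_sum sum_distrib_left)
  also have "\<dots> \<le> (\<Sum>t<n. stream_avg (cube d) ?u t (\<lambda>x. 2 * \<alpha> * ((exp \<epsilon> - 1) * sqrt N + 2 * \<delta> * N)))"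
  proof (intro sum_mono stream_avg_mono)
    fix t x assume "t \<in> {..<n}" "x \<in> {1..t} \<rightarrow>\<^sub>E cube d"
    then have "2 * \<alpha> / 2 ^ d * (\<Sum>l\<in>?\<Lambda>. c l t x)
        \<le> 2 * \<alpha> / 2 ^ d * (2 ^ d * ((exp \<epsilon> - 1) * sqrt N + 2 * \<delta> * N))"
      using \<alpha>(1) sum_c by (intro mult_left_mono) auto
    then show "2 * \<alpha> / 2 ^ d * (\<Sum>l\<in>?\<Lambda>. c l t x) \<le> 2 * \<alpha> * ((exp \<epsilon> - 1) * sqrt N + 2 * \<delta> * N)"
      by simp
  qed simp
  also have "\<dots> = n * (2 * \<alpha> * ((exp \<epsilon> - 1) * sqrt N + 2 * \<delta> * N))"
    by (simp add: stream_avg_const)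
  finally show ?thesis .
qed

text \<open>The triangle inequality over all \<open>(l, b)\<close> reduces the claim, for a fixed
  event, to the summed bound for each of the two signs. Dividing by \<open>2 * N\<close> turns
  \<open>sqrt N\<close> into \<open>1 / sqrt N\<close>.\<close>

lemma tv_dist_parity_le:
  assumes pan: "pan_private d n \<epsilon> \<delta> M" and "0 \<le> \<epsilon>" "0 \<le> \<delta>"
    and k: "1 \<le> k" "k \<le> d" and \<alpha>: "0 < \<alpha>" "\<alpha> < 1 / 2"
  defines "N \<equiv> real (binom_le d k)"
  shows "tv_dist (output_dist M n (parity_mixture_iid d k \<alpha> n)) (output_dist M n (iid n (unif_dist d)))
    \<le> n * (2 * \<alpha> * ((exp \<epsilon> - 1) / sqrt N + 2 * \<delta>))"
  unfolding tv_dist_def sets_output_dist_mixture[OF k \<alpha>]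
proof (rule cSUP_least)
  show "sets (output_space M) \<noteq> {}" by (metis empty_iff sets.top)
next
  fix A assume A: "A \<in> sets (output_space M)"
  define F where "F = (\<lambda>x. measure (run_alg M n x) A)"
  define R where "R = n * (2 * \<alpha> * ((exp \<epsilon> - 1) * sqrt N + 2 * \<delta> * N))"
  have N: "1 \<le> N" using binom_le_ge[OF k(1), of d] k by (simp add: N_def)
  let ?u = "stream_avg (cube d) (\<lambda>_. 1 / 2 ^ d) n F"
  let ?p = "\<lambda>l b. stream_avg (cube d) (parity_mass d l b \<alpha>) n F"
  have U: "measure (output_dist M n (iid n (unif_dist d))) A = ?u"
    unfolding F_def by (rule measure_output_dist_iid[OF unif_dist_discrete A])
  \<comment> \<open>The uniform case is written as an average over the same parameters, so that the
    difference can be taken term by term.\<close>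
  have u: "?u = (\<Sum>l\<in>parity_sets d k. \<Sum>b\<in>{-1, 1::real}. ?u) / (2 * N)"
    using N by (simp add: card_parity_sets N_def)
  have "\<bar>measure (output_dist M n (parity_mixture_iid d k \<alpha> n)) A
        - measure (output_dist M n (iid n (unif_dist d))) A\<bar>
      = \<bar>(\<Sum>l\<in>parity_sets d k. \<Sum>b\<in>{-1, 1}. ?p l b) / (2 * N)
        - (\<Sum>l\<in>parity_sets d k. \<Sum>b\<in>{-1, 1::real}. ?u) / (2 * N)\<bar>"
    unfolding U measure_output_dist_mixture[OF k \<alpha> A] u[symmetric] by (simp add: F_def N_def)
  also have "\<dots> = \<bar>\<Sum>l\<in>parity_sets d k. \<Sum>b\<in>{-1, 1}. ?p l b - ?u\<bar> / (2 * N)"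
    using N by (simp only: diff_divide_distrib[symmetric] sum_subtractf[symmetric] abs_divide)
  also have "\<dots> \<le> (\<Sum>b\<in>{-1, 1}. \<Sum>l\<in>parity_sets d k. \<bar>?p l b - ?u\<bar>) / (2 * N)"
  proof (rule divide_right_mono)
    have "\<bar>\<Sum>l\<in>parity_sets d k. \<Sum>b\<in>{-1, 1}. ?p l b - ?u\<bar>
        \<le> (\<Sum>l\<in>parity_sets d k. \<Sum>b\<in>{-1, 1}. \<bar>?p l b - ?u\<bar>)"
      by (intro order_trans[OF sum_abs] sum_mono sum_abs)
    then show "\<bar>\<Sum>l\<in>parity_sets d k. \<Sum>b\<in>{-1, 1}. ?p l b - ?u\<bar>
        \<le> (\<Sum>b\<in>{-1, 1}. \<Sum>l\<in>parity_sets d k. \<bar>?p l b - ?u\<bar>)"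
      by (subst sum.swap)
  qed (use N in simp)
  also have "\<dots> \<le> (\<Sum>b\<in>{-1, 1::real}. R) / (2 * N)"
    unfolding R_def N_def F_def using assms A
    by (intro divide_right_mono sum_mono sum_parity_advantage_le) auto
  also have "\<dots> = R / N" by simp
  also have "\<dots> = n * (2 * \<alpha> * ((exp \<epsilon> - 1) * (sqrt N / N) + 2 * \<delta>))"
    using N by (simp add: R_def field_simps)
  also have "sqrt N / N = 1 / sqrt N"
    using N by (simp add: field_simps)
  finally show "\<bar>measure (output_dist M n (parity_mixture_iid d k \<alpha> n)) A
        - measure (output_dist M n (iid n (unif_dist d))) A\<bar>
      \<le> n * (2 * \<alpha> * ((exp \<epsilon> - 1) / sqrt N + 2 * \<delta>))" by simp
qed

end

section \<open>From the total variation bound to the lower bound on the stream length\<close>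

lemma exp_minus_one_le:
  fixes \<epsilon> \<epsilon>\<^sub>0 :: real
  assumes "0 \<le> \<epsilon>" "\<epsilon> \<le> \<epsilon>\<^sub>0"
  shows "exp \<epsilon> - 1 \<le> \<epsilon> * exp \<epsilon>\<^sub>0"
proof -
  have "(1 - \<epsilon>) * exp \<epsilon> \<le> exp (-\<epsilon>) * exp \<epsilon>"
    using exp_ge_add_one_self[of "-\<epsilon>"] by (intro mult_right_mono) auto
  then have "exp \<epsilon> - 1 \<le> \<epsilon> * exp \<epsilon>" by (simp add: exp_minus left_diff_distrib)
  also have "\<dots> \<le> \<epsilon> * exp \<epsilon>\<^sub>0" using assms by (intro mult_left_mono) auto
  finally show ?thesis .
qed

text \<open>The cap \<open>\<epsilon>\<^sub>0\<close> makes \<open>exp \<epsilon> - 1\<close> at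
  most a constant times \<open>\<epsilon>\<close>. For \<open>d = 1\<close> the family has
  \<open>N = 1\<close>, and \<open>\<delta>\<close> near 1 would make
  \<open>\<delta> * ln (N / \<delta>)\<close> small without being small itself; the bound
  \<open>1/2\<close> excludes this.\<close>

theorem theorem3p11:
  fixes \<gamma> \<epsilon>\<^sub>0 :: real
  assumes "\<gamma> > 0" and "\<epsilon>\<^sub>0 > 0"
  shows "\<exists>c>0. \<exists>C>0.
    \<forall>(d::nat) (k::nat) (n::nat) (\<alpha>::real) (\<epsilon>::real) (\<delta>::real) (M :: ('i, 'o) online_alg).
      1 \<le> k \<and> k \<le> d \<and> 1 \<le> n \<and> 0 < \<alpha> \<and> \<alpha> < 1/2 \<and>
      0 < \<epsilon> \<and> \<epsilon> \<le> \<epsilon>\<^sub>0 \<and> 0 \<le> \<delta> \<and> \<delta> \<le> 1 \<and> (d = 1 \<longrightarrow> \<delta> \<le> 1/2) \<and>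
      online_algorithm d n M \<and> pan_private d n \<epsilon> \<delta> M \<and>
      \<delta> * ln (real (binom_le d k) / \<delta>) \<le> c * \<alpha>\<^sup>2 * \<epsilon>\<^sup>2 / real (binom_le d k) \<and>
      tv_dist (output_dist M n (parity_mixture_iid d k \<alpha> n))
              (output_dist M n (iid n (unif_dist d))) \<ge> \<gamma>
      \<longrightarrow> real n \<ge> C * sqrt (real (binom_le d k)) / (\<alpha> * \<epsilon>)"
\<comment> \<open>In the constant \<open>C\<close>, \<open>exp \<epsilon>\<^sub>0\<close> comes from
  the linear bound on \<open>exp \<epsilon> - 1\<close>, the summand
  \<open>\<epsilon>\<^sub>0\<close> from the \<open>\<delta>\<close> term, and the factor 2 from
  \<open>2 * \<alpha>\<close>.\<close>
proof (rule exI[of _ 1], intro conjI exI[of _ "\<gamma> / (2 * (exp \<epsilon>\<^sub>0 + \<epsilon>\<^sub>0))"] allI impI)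
  show "\<gamma> / (2 * (exp \<epsilon>\<^sub>0 + \<epsilon>\<^sub>0)) > 0" using assms by (simp add: add_pos_pos)
next
  fix d k n :: nat and \<alpha> \<epsilon> \<delta> :: real and M :: "('i, 'o) online_alg"
  define N where "N = real (binom_le d k)"
  assume "1 \<le> k \<and> k \<le> d \<and> 1 \<le> n \<and> 0 < \<alpha> \<and> \<alpha> < 1/2 \<and>
      0 < \<epsilon> \<and> \<epsilon> \<le> \<epsilon>\<^sub>0 \<and> 0 \<le> \<delta> \<and> \<delta> \<le> 1 \<and> (d = 1 \<longrightarrow> \<delta> \<le> 1/2) \<and>
      online_algorithm d n M \<and> pan_private d n \<epsilon> \<delta> M \<and>
      \<delta> * ln (real (binom_le d k) / \<delta>) \<le> 1 * \<alpha>\<^sup>2 * \<epsilon>\<^sup>2 / real (binom_le d k) \<and>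
      tv_dist (output_dist M n (parity_mixture_iid d k \<alpha> n))
              (output_dist M n (iid n (unif_dist d))) \<ge> \<gamma>"
  then have k: "1 \<le> k" "k \<le> d" and n: "1 \<le> n" and \<alpha>: "0 < \<alpha>" "\<alpha> < 1/2" and \<epsilon>: "0 < \<epsilon>" "\<epsilon> \<le> \<epsilon>\<^sub>0"
    and \<delta>: "0 \<le> \<delta>" "\<delta> \<le> 1" "d = 1 \<longrightarrow> \<delta> \<le> 1/2"
    and M: "online_algorithm d n M" and pan: "pan_private d n \<epsilon> \<delta> M"
    and small: "\<delta> * ln (N / \<delta>) \<le> \<alpha>\<^sup>2 * \<epsilon>\<^sup>2 / N"
    and tv: "\<gamma> \<le> tv_dist (output_dist M n (parity_mixture_iid d k \<alpha> n)) (output_dist M n (iid n (unif_dist d)))"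
    by (auto simp: N_def)
  have dN: "real d \<le> N" using binom_le_ge[OF k(1), of d] by (simp add: N_def)
  then have N: "1 \<le> N" using k by simp
  have sqrtN: "1 \<le> sqrt N" "sqrt N * sqrt N = N" using N by auto
  \<comment> \<open>The logarithm is bounded below by \<open>ln 2\<close>, which turns the
    hypothesis into a bound on \<open>\<delta>\<close> itself. This needs
    \<open>N / \<delta> \<ge> 2\<close>: for \<open>d \<ge> 2\<close> it follows from
    \<open>N \<ge> d\<close> and \<open>\<delta> \<le> 1\<close>, for \<open>d = 1\<close> from
    \<open>\<delta> \<le> 1/2\<close>.\<close>
  have "\<delta> * (1 / 2) \<le> \<delta> * ln (N / \<delta>)"
  proof (cases "\<delta> = 0")
    case False
    then have "0 < \<delta>" using \<delta> by simp
    have "2 * \<delta> \<le> N"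
    proof (cases "d = 1")
      case False
      then have "2 \<le> real d" using k by simp
      then show ?thesis using dN \<delta>(2) by linarith
    qed (use \<delta> N in auto)
    then have "ln 2 \<le> ln (N / \<delta>)" using \<open>0 < \<delta>\<close> N by (simp add: field_simps)
    moreover have "1 / 2 \<le> ln (2::real)" using ln2_ge_two_thirds by simp
    ultimately show ?thesis using \<delta>(1) by (intro mult_left_mono) auto
  qed simp
  then have "2 * \<delta> \<le> 4 * (\<alpha>\<^sup>2 * \<epsilon>\<^sup>2) / N" using small by simp
  \<comment> \<open>The factor 4 is absorbed by \<open>\<alpha> < 1/2\<close>, one
    \<open>\<epsilon>\<close> is traded for \<open>\<epsilon>\<^sub>0\<close>, and
    \<open>1 / N\<close> is weakened to \<open>1 / sqrt N\<close>, the order of the main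
    term.\<close>
  also have "\<dots> \<le> \<epsilon> * \<epsilon>\<^sub>0 / sqrt N"
  proof (rule frac_le)
    have "\<alpha>\<^sup>2 \<le> (1/2)\<^sup>2" using \<alpha> by (intro power_mono) auto
    then have "4 * \<alpha>\<^sup>2 * \<epsilon>\<^sup>2 \<le> 1 * \<epsilon>\<^sup>2" by (intro mult_right_mono) (auto simp: power2_eq_square)
    also have "\<dots> \<le> \<epsilon> * \<epsilon>\<^sub>0" using \<epsilon> by (simp add: power2_eq_square mult_left_mono)
    finally show "4 * (\<alpha>\<^sup>2 * \<epsilon>\<^sup>2) \<le> \<epsilon> * \<epsilon>\<^sub>0" by simp
    show "sqrt N \<le> N" using sqrtN by (metis mult_left_mono mult.right_neutral order_trans zero_le_one)
  qed (use \<epsilon> N in auto)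
  finally have d2: "2 * \<delta> \<le> \<epsilon> * \<epsilon>\<^sub>0 / sqrt N" .
  have e1: "(exp \<epsilon> - 1) / sqrt N \<le> \<epsilon> * exp \<epsilon>\<^sub>0 / sqrt N"
    using exp_minus_one_le[of \<epsilon> \<epsilon>\<^sub>0] \<epsilon> N by (intro divide_right_mono) auto
  have "\<gamma> \<le> n * (2 * \<alpha> * ((exp \<epsilon> - 1) / sqrt N + 2 * \<delta>))"
    using tv tv_dist_parity_le[OF M n pan _ \<delta>(1) k \<alpha>] \<epsilon>(1) by (simp add: N_def)
  also have "\<dots> \<le> n * (2 * \<alpha> * (\<epsilon> * exp \<epsilon>\<^sub>0 / sqrt N + \<epsilon> * \<epsilon>\<^sub>0 / sqrt N))"
    using d2 e1 \<alpha> by (intro mult_left_mono add_mono) auto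
  also have "\<dots> = n * (\<alpha> * \<epsilon>) * (2 * (exp \<epsilon>\<^sub>0 + \<epsilon>\<^sub>0)) / sqrt N"
    by (simp add: algebra_simps add_divide_distrib)
  finally have "\<gamma> * sqrt N \<le> n * (\<alpha> * \<epsilon>) * (2 * (exp \<epsilon>\<^sub>0 + \<epsilon>\<^sub>0))"
    using sqrtN(1) by (simp add: pos_le_divide_eq)
  then have "\<gamma> * sqrt N / (2 * (exp \<epsilon>\<^sub>0 + \<epsilon>\<^sub>0)) \<le> n * (\<alpha> * \<epsilon>)"
    using assms(2) by (simp add: pos_divide_le_eq add_pos_pos)
  then show "\<gamma> / (2 * (exp \<epsilon>\<^sub>0 + \<epsilon>\<^sub>0)) * sqrt (real (binom_le d k)) / (\<alpha> * \<epsilon>) \<le> real n"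
    unfolding N_def[symmetric] times_divide_eq_left
    using \<alpha>(1) \<epsilon>(1) by (subst pos_divide_le_eq) auto
qed simp

end
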